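(* Consider inverse limits $(X,f)$ of bidirectional proximal KR-coverings $G_0\xleftarrow{\varphi_1}G_1\xleftarrow{\varphi_2}\cdots$ such that for every $n\ge1$ the graph $G_n$ has exactly two circuits, $e_n$ of length $1$ and $c_n$, and $$\varphi_{n+1}(c_{n+1})=e_n^{s(n)}\,c_n^{\bar t(n)}\,e_n^{s'(n)}\qquad(n\ge1),$$ where $s(n),s'(n)$ are positive integers and $\bar t(n)=t(n)+t'(n)$ with integers $t(n),t'(n)\ge2$. There exist such a covering and sequences $s(n)$, $s'(n)$, $\bar t(n)$ ($n\ge1$) such that $(X,f)$ is not weakly mixing. Both non-weakly-mixing systems of this kind that are uniquely ergodic and ones that have exactly two ergodic measures are possible. In each case the sequences can be taken such that $s(n)=s'(n)$ for all $n\ge1$.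
   Context: Dynamics. A homeomorphic system $(X,f)$ is topologically transitive if some $x\in X$ has dense forward orbit $\{f^n(x):n\ge0\}$, and weakly mixing if $(X\times X,f\times f)$ is topologically transitive. "Ergodic measure" means ergodic $f$-invariant Borel probability measure; uniquely ergodic means having exactly one invariant Borel probability measure. Graph coverings. A finite directed graph $G=(V(G),E(G))$ has $E(G)\subseteq V(G)\times V(G)$, and every vertex is assumed to have an incoming and an outgoing edge. A graph homomorphism $\varphi:G_1\to G_2$ is edge-surjective if $\varphi(E(G_1))=E(G_2)$; it is $+$directional if $(u,v),(u,v')\in E(G_1)$ implies $\varphi(v)=\varphi(v')$; it is bidirectional if moreover $(u,v),(u',v)\in E(G_1)$ implies $\varphi(u)=\varphi(u')$. A cover is a $+$directional edge-surjective homomorphism. A covering is a sequence of covers $G_0\xleftarrow{\varphi_1}G_1\xleftarrow{\varphi_2}\cdots$ with $G_0$ the graph with one vertex and one loop; it is bidirectional if all $\varphi_n$ are. Its inverse limit is $(X,f)$ with $X=\{(v_0,v_1,\dots)\in\prod_nV(G_n): v_n=\varphi_{n+1}(v_{n+1})\}$ (product topology) and $f(x)=y$ iff $(u_n,v_n)\in E(G_n)$ for all $n$, where $x=(u_n)_n$, $y=(v_n)_n$. A circuit of length $l\ge1$ is a closed walk $(v_0,\dots,v_l=v_0)$ with $v_0,\dots,v_{l-1}$ distinct. A generalized figure 8 is a graph $G$ with a center $v_0$ and distinct circuits starting at $v_0$, pairwise meeting only in $v_0$, whose edges exhaust $E(G)$. A KR-covering is a covering in which each $G_n$ is a generalized figure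 8 with center $v_{n,0}$ and $\varphi_{n+1}(v_{n+1,0})=v_{n,0}$ for all $n\ge0$. It is proximal if for each $n\ge1$ the graph $G_n$ has a unique circuit of length $1$. Images of walks are taken vertexwise; products and powers of closed walks at the center denote concatenation. Such inverse limits are proximal Cantor systems with topological rank $2$. *)

theory Defs
  imports
    "HOL-Probability.Probability"
    "Graph_Theory.Pair_Digraph"
    "Graph_Theory.Vertex_Walk"
begin

text \<open>A system is given by a subset X of a topological space, carrying the subspace topology,
  and a self-map f of X; the values of f outside X play no role.\<close>

definition topologically_transitive :: "'a::topological_space set \<Rightarrow> ('a \<Rightarrow> 'a) \<Rightarrow> bool" where
  "topologically_transitive X f \<longleftrightarrow> (\<exists>x\<in>X. X \<subseteq> closure {(f ^^ n) x |n. True})"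

definition weakly_mixing :: "'a::topological_space set \<Rightarrow> ('a \<Rightarrow> 'a) \<Rightarrow> bool" where
  "weakly_mixing X f \<longleftrightarrow> topologically_transitive (X \<times> X) (map_prod f f)"

definition invariant_measure ::
    "'a::topological_space set \<Rightarrow> ('a \<Rightarrow> 'a) \<Rightarrow> 'a measure \<Rightarrow> bool" where
  "invariant_measure X f M \<longleftrightarrow>
     space M = X \<and> sets M = sets (restrict_space borel X) \<and> prob_space M \<and>
     f \<in> M \<rightarrow>\<^sub>M M \<and> distr M M f = M"

definition ergodic_measure ::
    "'a::topological_space set \<Rightarrow> ('a \<Rightarrow> 'a) \<Rightarrow> 'a measure \<Rightarrow> bool" where
  "ergodic_measure X f M \<longleftrightarrow>
     invariant_measure X f M \<and>
     (\<forall>A\<in>sets M. f -` A \<inter> space M = A \<longrightarrow> measure M A = 0 \<or> measure M A = 1)"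

definition uniquely_ergodic :: "'a::topological_space set \<Rightarrow> ('a \<Rightarrow> 'a) \<Rightarrow> bool" where
  "uniquely_ergodic X f \<longleftrightarrow> (\<exists>!M. invariant_measure X f M)"

definition cov_graph :: "'v pair_pre_digraph \<Rightarrow> bool" where
  "cov_graph G \<longleftrightarrow> pair_fin_digraph G \<and>
     (\<forall>v\<in>pverts G. (\<exists>u. (u, v) \<in> parcs G) \<and> (\<exists>w. (v, w) \<in> parcs G))"

definition graph_hom ::
    "('v \<Rightarrow> 'w) \<Rightarrow> 'v pair_pre_digraph \<Rightarrow> 'w pair_pre_digraph \<Rightarrow> bool" where
  "graph_hom \<phi> G H \<longleftrightarrow> \<phi> ` pverts G \<subseteq> pverts H \<and>
     (\<forall>u v. (u, v) \<in> parcs G \<longrightarrow> (\<phi> u, \<phi> v) \<in> parcs H)"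

definition edge_surjective ::
    "('v \<Rightarrow> 'w) \<Rightarrow> 'v pair_pre_digraph \<Rightarrow> 'w pair_pre_digraph \<Rightarrow> bool" where
  "edge_surjective \<phi> G H \<longleftrightarrow> map_prod \<phi> \<phi> ` parcs G = parcs H"

definition plus_directional :: "('v \<Rightarrow> 'w) \<Rightarrow> 'v pair_pre_digraph \<Rightarrow> bool" where
  "plus_directional \<phi> G \<longleftrightarrow>
     (\<forall>u v v'. (u, v) \<in> parcs G \<and> (u, v') \<in> parcs G \<longrightarrow> \<phi> v = \<phi> v')"

definition bidirectional :: "('v \<Rightarrow> 'w) \<Rightarrow> 'v pair_pre_digraph \<Rightarrow> bool" where
  "bidirectional \<phi> G \<longleftrightarrow> plus_directional \<phi> G \<and>
     (\<forall>u u' v. (u, v) \<in> parcs G \<and> (u', v) \<in> parcs G \<longrightarrow> \<phi> u = \<phi> u')"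

definition cover ::
    "('v \<Rightarrow> 'w) \<Rightarrow> 'v pair_pre_digraph \<Rightarrow> 'w pair_pre_digraph \<Rightarrow> bool" where
  "cover \<phi> G H \<longleftrightarrow> graph_hom \<phi> G H \<and> edge_surjective \<phi> G H \<and> plus_directional \<phi> G"

text \<open>The bonding map from the graph with index n + 1 to the one with index n
  is \<open>\<phi> (Suc n)\<close>; the value \<open>\<phi> 0\<close> is never used.\<close>

definition covering :: "(nat \<Rightarrow> 'v pair_pre_digraph) \<Rightarrow> (nat \<Rightarrow> 'v \<Rightarrow> 'v) \<Rightarrow> bool" where
  "covering G \<phi> \<longleftrightarrow>
     (\<forall>n. cov_graph (G n)) \<and>
     (\<exists>v. pverts (G 0) = {v} \<and> parcs (G 0) = {(v, v)}) \<and>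
     (\<forall>n. cover (\<phi> (Suc n)) (G (Suc n)) (G n))"

definition bidirectional_covering ::
    "(nat \<Rightarrow> 'v pair_pre_digraph) \<Rightarrow> (nat \<Rightarrow> 'v \<Rightarrow> 'v) \<Rightarrow> bool" where
  "bidirectional_covering G \<phi> \<longleftrightarrow>
     covering G \<phi> \<and> (\<forall>n. bidirectional (\<phi> (Suc n)) (G (Suc n)))"

definition inv_limit ::
    "(nat \<Rightarrow> 'v pair_pre_digraph) \<Rightarrow> (nat \<Rightarrow> 'v \<Rightarrow> 'v) \<Rightarrow> (nat \<Rightarrow> 'v) set" where
  "inv_limit G \<phi> = {x. (\<forall>n. x n \<in> pverts (G n)) \<and> (\<forall>n. x n = \<phi> (Suc n) (x (Suc n)))}"

definition inv_limit_map ::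
    "(nat \<Rightarrow> 'v pair_pre_digraph) \<Rightarrow> (nat \<Rightarrow> 'v \<Rightarrow> 'v) \<Rightarrow> (nat \<Rightarrow> 'v) \<Rightarrow> nat \<Rightarrow> 'v" where
  "inv_limit_map G \<phi> x = (THE y. y \<in> inv_limit G \<phi> \<and> (\<forall>n. (x n, y n) \<in> parcs (G n)))"

text \<open>The definite description is legitimate on the inverse limit of a covering.\<close>

lemma inv_limit_map_ex1:
  assumes cov: "covering G \<phi>" and x: "x \<in> inv_limit G \<phi>"
  shows "\<exists>!y. y \<in> inv_limit G \<phi> \<and> (\<forall>n. (x n, y n) \<in> parcs (G n))"
proof -
  have dir: "\<phi> (Suc n) v = \<phi> (Suc n) v'"
    if "(u, v) \<in> parcs (G (Suc n))" "(u, v') \<in> parcs (G (Suc n))" for n u v v'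
  proof -
    have "plus_directional (\<phi> (Suc n)) (G (Suc n))"
      using cov by (simp add: covering_def cover_def)
    then show ?thesis
      unfolding plus_directional_def using that by blast
  qed
  have hom: "(\<phi> (Suc n) u, \<phi> (Suc n) v) \<in> parcs (G n)"
    if "(u, v) \<in> parcs (G (Suc n))" for n u v
    using that cov by (simp add: covering_def cover_def graph_hom_def)
  have xn: "x n = \<phi> (Suc n) (x (Suc n))" "x n \<in> pverts (G n)" for n
    using x unfolding inv_limit_def by blast+
  have "\<forall>n. \<exists>w. (x n, w) \<in> parcs (G n)"
    using xn(2) cov by (simp add: covering_def cov_graph_def)
  from choice[OF this] obtain w where w: "\<And>n. (x n, w n) \<in> parcs (G n)"
    by blast
  define y where "y = (\<lambda>n. \<phi> (Suc n) (w (Suc n)))"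
  have yE: "(x n, y n) \<in> parcs (G n)" for n
    unfolding y_def using hom[OF w[of "Suc n"]] by (simp flip: xn(1))
  have fin: "pair_fin_digraph (G n)" for n
    using cov by (auto simp: covering_def cov_graph_def)
  have "y n = \<phi> (Suc n) (y (Suc n))" for n
    using dir[OF w[of "Suc n"] yE[of "Suc n"]] by (simp add: y_def)
  moreover have "y n \<in> pverts (G n)" for n
    using pair_wf_digraph.in_arcsD2[OF _ yE[of n]] fin[of n]
    by (simp add: pair_fin_digraph_def)
  ultimately have yX: "y \<in> inv_limit G \<phi>"
    unfolding inv_limit_def by blast
  show ?thesis
  proof (rule ex1I[of _ y])
    show "y \<in> inv_limit G \<phi> \<and> (\<forall>n. (x n, y n) \<in> parcs (G n))"
      using yX yE by blast
  next
    fix z assume z: "z \<in> inv_limit G \<phi> \<and> (\<forall>n. (x n, z n) \<in> parcs (G n))"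
    show "z = y"
    proof
      fix n
      have "z n = \<phi> (Suc n) (z (Suc n))"
        using conjunct1[OF z] unfolding inv_limit_def by blast
      also have "\<dots> = \<phi> (Suc n) (w (Suc n))"
        using dir[OF conjunct2[OF z, THEN spec] w] .
      finally show "z n = y n"
        by (simp only: y_def)
    qed
  qed
qed

text \<open>A walk of length l is the list of its l + 1 vertices, so that a circuit repeats its
  base point at the end.\<close>

definition circuit :: "'v pair_pre_digraph \<Rightarrow> 'v vwalk \<Rightarrow> bool" where
  "circuit G p \<longleftrightarrow>
     vwalk p G \<and> vwalk_length p \<ge> 1 \<and> hd p = last p \<and> distinct (butlast p)"

definition gen_figure_8 :: "'v pair_pre_digraph \<Rightarrow> 'v \<Rightarrow> bool" where
  "gen_figure_8 G v0 \<longleftrightarrow> v0 \<in> pverts G \<and>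
     (\<exists>C. (\<forall>p\<in>C. circuit G p \<and> hd p = v0) \<and>
          (\<forall>p\<in>C. \<forall>q\<in>C. p \<noteq> q \<longrightarrow> set p \<inter> set q = {v0}) \<and>
          (\<Union>p\<in>C. set (vwalk_arcs p)) = parcs G)"

definition KR_covering ::
    "(nat \<Rightarrow> 'v pair_pre_digraph) \<Rightarrow> (nat \<Rightarrow> 'v \<Rightarrow> 'v) \<Rightarrow> (nat \<Rightarrow> 'v) \<Rightarrow> bool" where
  "KR_covering G \<phi> ctr \<longleftrightarrow> covering G \<phi> \<and>
     (\<forall>n. gen_figure_8 (G n) (ctr n)) \<and> (\<forall>n. \<phi> (Suc n) (ctr (Suc n)) = ctr n)"

definition proximal_covering :: "(nat \<Rightarrow> 'v pair_pre_digraph) \<Rightarrow> bool" where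
  "proximal_covering G \<longleftrightarrow> (\<forall>n\<ge>1. \<exists>!p. circuit (G n) p \<and> vwalk_length p = 1)"

primrec vwalk_power :: "'v vwalk \<Rightarrow> nat \<Rightarrow> 'v vwalk" where
  "vwalk_power p 0 = [hd p]"
| "vwalk_power p (Suc k) = p \<oplus> vwalk_power p k"

text \<open>In a generalized figure 8 every circuit passes through the center, so circuits (as cyclic
  objects) are listed without repetition by the closed walks based at the center.\<close>

definition two_circuit_covering ::
    "(nat \<Rightarrow> 'v pair_pre_digraph) \<Rightarrow> (nat \<Rightarrow> 'v \<Rightarrow> 'v) \<Rightarrow>
     (nat \<Rightarrow> nat) \<Rightarrow> (nat \<Rightarrow> nat) \<Rightarrow> (nat \<Rightarrow> nat) \<Rightarrow> bool" where
  "two_circuit_covering G \<phi> s s' tbar \<longleftrightarrow>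
     bidirectional_covering G \<phi> \<and> proximal_covering G \<and>
     (\<forall>n\<ge>1. s n > 0 \<and> s' n > 0 \<and> (\<exists>t t'. t \<ge> 2 \<and> t' \<ge> 2 \<and> tbar n = t + t')) \<and>
     (\<exists>ctr e c. KR_covering G \<phi> ctr \<and>
        (\<forall>n\<ge>1. {p. circuit (G n) p \<and> hd p = ctr n} = {e n, c n} \<and> e n \<noteq> c n \<and>
                vwalk_length (e n) = 1) \<and>
        (\<forall>n\<ge>1. map (\<phi> (Suc n)) (c (Suc n)) =
           vwalk_power (e n) (s n) \<oplus> vwalk_power (c n) (tbar n) \<oplus> vwalk_power (e n) (s' n)))"

end

theory Submission
  imports Defs
begin

text \<open>
All three parts come from one family of examples. The graph of level n has vertices
\<open>0, ..., L - 1\<close> with a loop at the center 0 and one cycle of length \<open>L = len s n\<close>. The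
cycle of level \<open>n + 1\<close> is wrapped as \<open>loop^s cycle^4 loop^s\<close> around the graph of
level n, with \<open>s = s n\<close> on both sides, so the lengths satisfy
\<open>len s (n + 1) = 2 * s n + 4 * len s n\<close>.

No nonconstant continuous eigenfunction can obstruct weak mixing, because every orbit comes near
the fixed point that stays at the center on all levels. But if all \<open>s n\<close> and all lengths
are divisible by 3 from level 1 on, then a point other than the fixed point has a phase modulo 3:
its position on the cycle at any level where it is not at the center (\<open>phase_Suc\<close>). The phase
is continuous off the fixed point and advances by 1 with each step. So the phase difference of a
pair is constant along its orbit, and no orbit of pairs is dense (\<open>not_weakly_mixing\<close>).

Under an invariant measure all vertices of the cycle other than the center have the same mass,
and this common mass drops by the factor 4 from each level to the next. A single number thus
determines the measure (\<open>measure_cyl\<close>). If the lengths grow faster than \<open>4 ^ n\<close>, total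
mass 1 forces that number to be 0, and the point mass at the fixed point is the only invariant
measure (\<open>uniquely_ergodicI\<close>). In general an ergodic measure is this point mass or gives the
fixed point mass 0, and at most one invariant measure does the latter (\<open>nonatomic_unique\<close>);
if it exists, there are exactly two ergodic measures (\<open>two_ergodic_measures\<close>).

It exists when all \<open>s n\<close> with \<open>n \<ge> 1\<close> are 3. Then \<open>len s n = 2 * 4 ^ n - 2\<close>, so giving
mass 1 to every vertex of the cycle other than the center, and mass 3 to the center, distributes
the total mass \<open>2 * 4 ^ n\<close> compatibly with the projections. A measure with these masses is
obtained as an image of Lebesgue measure on the unit interval, cut on level n into
\<open>2 * 4 ^ n\<close> equal pieces (\<open>coded_measure_cyl\<close>).
\<close>

section \<open>A loop and a cycle at a common center\<close>

definition loop_and_cycle :: "nat \<Rightarrow> nat pair_pre_digraph" where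
  "loop_and_cycle l =
     \<lparr>pverts = {0..<l}, parcs = {(u, v). u < l \<and> (v = Suc u mod l \<or> u = 0 \<and> v = 0)}\<rparr>"

lemma loop_and_cycle_simps [simp]:
  "pverts (loop_and_cycle l) = {0..<l}"
  "(u, v) \<in> parcs (loop_and_cycle l) \<longleftrightarrow> u < l \<and> (v = Suc u mod l \<or> u = 0 \<and> v = 0)"
  by (simp_all add: loop_and_cycle_def)

lemma cov_graph_loop_and_cycle:
  assumes "l > 0"
  shows "cov_graph (loop_and_cycle l)"
proof -
  have sub: "parcs (loop_and_cycle l) \<subseteq> {0..<l} \<times> {0..<l}"
    using assms by auto
  have "pair_fin_digraph (loop_and_cycle l)"
    using sub finite_subset[OF sub] by unfold_locales auto
  moreover have "\<exists>u. (u, v) \<in> parcs (loop_and_cycle l)" if "v < l" for v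
  proof (cases v)
    case 0
    then show ?thesis using assms by auto
  next
    case (Suc u)
    then show ?thesis using that by (intro exI[of _ u]) simp
  qed
  ultimately show ?thesis
    by (auto simp: cov_graph_def)
qed

lemma set_vwalk_arcs_nth: "set (vwalk_arcs p) = {(p ! i, p ! Suc i) |i. Suc i < length p}"
proof (induction p rule: vwalk_arcs.induct)
  case (3 x y xs)
  have "{(p ! i, p ! Suc i) |i. Suc i < length p} =
      insert (x, y) {((y # xs) ! i, (y # xs) ! Suc i) |i. Suc i < length (y # xs)}"
    if "p = x # y # xs" for p
  proof (intro set_eqI iffI)
    fix a
    assume "a \<in> {(p ! i, p ! Suc i) |i. Suc i < length p}"
    then obtain i where "a = (p ! i, p ! Suc i)" "Suc i < length p" by blast
    then show "a \<in> insert (x, y) {((y # xs) ! i, (y # xs) ! Suc i) |i. Suc i < length (y # xs)}"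
      using that by (cases i) auto
  next
    fix a
    assume "a \<in> insert (x, y) {((y # xs) ! i, (y # xs) ! Suc i) |i. Suc i < length (y # xs)}"
    then consider "a = (x, y)"
      | i where "a = ((y # xs) ! i, (y # xs) ! Suc i)" "Suc i < length (y # xs)"
      by blast
    then show "a \<in> {(p ! i, p ! Suc i) |i. Suc i < length p}"
    proof cases
      case 1
      then show ?thesis using that by (force intro: exI[of _ 0])
    next
      case 2
      then show ?thesis using that by (force intro: exI[of _ "Suc i"])
    qed
  qed
  from this[OF refl] show ?case using 3 by simp
qed auto

lemma vwalk_with_proj_iff:
  "vwalk p (with_proj G) \<longleftrightarrow>
     p \<noteq> [] \<and> set p \<subseteq> pverts G \<and> (\<forall>i. Suc i < length p \<longrightarrow> (p ! i, p ! Suc i) \<in> parcs G)"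
proof -
  have "arcs_ends (with_proj G) = parcs G"
    by (auto simp: arcs_ends_def arc_to_ends_def with_proj_def)
  then show ?thesis
    by (auto simp: vwalk_def set_vwalk_arcs_nth with_proj_def)
qed

abbreviation (input) cycle_walk :: "nat \<Rightarrow> nat vwalk" where
  "cycle_walk l \<equiv> [0..<l] @ [0]"

lemma nth_cycle_walk: "i \<le> l \<Longrightarrow> l > 0 \<Longrightarrow> cycle_walk l ! i = i mod l"
  by (auto simp: nth_append)

lemma circuit_loop: "l > 0 \<Longrightarrow> circuit (loop_and_cycle l) [0, 0]"
  by (auto simp: circuit_def vwalk_with_proj_iff nth_Cons split: nat.splits)

lemma circuit_cycle_walk: "l > 0 \<Longrightarrow> circuit (loop_and_cycle l) (cycle_walk l)"
  by (auto simp: circuit_def vwalk_with_proj_iff nth_append hd_append not_less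
      dest: antisym[OF Suc_leI])

text \<open>Away from the center every vertex has a single successor, and a circuit returns to the center
only at its end. So its first step decides everything: staying at the center closes the loop,
and leaving it forces the whole cycle.\<close>

lemma circuit_at_0_cases:
  assumes "l > 0" and p: "circuit (loop_and_cycle l) p" and hd: "hd p = 0"
  shows "p = [0, 0] \<or> p = cycle_walk l"
proof (cases "p ! 1 = 0")
  case True
  have len: "length p \<ge> 2" and lst: "last p = 0" and dist: "distinct (butlast p)"
    using p hd by (auto simp: circuit_def)
  then obtain a b r where abr: "p = a # b # r"
    by (metis One_nat_def Suc_1 Suc_le_length_iff length_Cons list.exhaust list.size(3) not_less_eq_eq zero_le)
  then have "a = 0" "b = 0" using hd True by auto
  with abr dist show ?thesis by (cases r) auto
next
  case False
  define m where "m = length p - 1"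
  have m: "length p = Suc m" "m \<ge> 1" and lst: "last p = 0" and dist: "distinct (butlast p)"
    and arcs: "\<And>i. Suc i < length p \<Longrightarrow> (p ! i, p ! Suc i) \<in> parcs (loop_and_cycle l)"
    using p hd by (auto simp: circuit_def vwalk_with_proj_iff m_def)
  have p0: "p ! 0 = 0" using hd m by (metis hd_conv_nth length_0_conv nat.distinct(1))
  have pm: "p ! m = 0" using lst m by (metis diff_Suc_1 last_conv_nth length_0_conv nat.distinct(1))
  have nz: "p ! i \<noteq> 0" if "0 < i" "i < m" for i
  proof
    assume "p ! i = 0"
    then have "butlast p ! i = butlast p ! 0" using that m p0 by (simp add: nth_butlast)
    then show False using nth_eq_iff_index_eq[OF dist, of i 0] that m by simp
  qed
  have step: "p ! Suc i = Suc (p ! i) mod l \<and> p ! i < l" if "i < m" for i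
  proof -
    have "(p ! i, p ! Suc i) \<in> parcs (loop_and_cycle l)" using arcs that m by simp
    then show ?thesis using nz[of i] that False p0 by (cases "i = 0") auto
  qed
  have id: "p ! i = i" if "i < m" for i
    using that
  proof (induction i)
    case (Suc i)
    then have "p ! Suc i = Suc i mod l" "i < l" "p ! Suc i \<noteq> 0"
      using step[of i] nz[of "Suc i"] by auto
    then show ?case by (cases "Suc i = l") auto
  qed (use p0 in simp)
  have "Suc (m - 1) mod l = 0" "m - 1 < l"
    using step[of "m - 1"] id[of "m - 1"] m pm by auto
  then have ml: "m = l"
    using m by (cases "m = l") auto
  have "p = cycle_walk l"
  proof (rule nth_equalityI)
    fix i assume "i < length p"
    then show "p ! i = cycle_walk l ! i"
      using id[of i] pm ml m by (cases "i = m") (auto simp: nth_append)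
  qed (use ml m in simp)
  then show ?thesis by simp
qed

lemma circuits_at_0:
  "l > 0 \<Longrightarrow> {p. circuit (loop_and_cycle l) p \<and> hd p = 0} = {[0, 0], cycle_walk l}"
proof (intro equalityI subsetI)
  fix p assume "l > 0" "p \<in> {p. circuit (loop_and_cycle l) p \<and> hd p = 0}"
  then show "p \<in> {[0, 0], cycle_walk l}"
    using circuit_at_0_cases[of l p] by blast
next
  fix p assume "l > 0" "p \<in> {[0, 0], cycle_walk l}"
  moreover from \<open>l > 0\<close> have "hd (cycle_walk l) = 0" by (simp add: hd_append)
  ultimately show "p \<in> {p. circuit (loop_and_cycle l) p \<and> hd p = 0}"
    using circuit_loop[of l] circuit_cycle_walk[of l] by (elim insertE) simp_all
qed

lemma vwalk_arcs_cycle_walk: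
  assumes "l > 0"
  shows "(u, v) \<in> set (vwalk_arcs (cycle_walk l)) \<longleftrightarrow> u < l \<and> v = Suc u mod l"
proof -
  have eq: "cycle_walk l ! i = i \<and> cycle_walk l ! Suc i = Suc i mod l" if "i < l" for i
    using that by (simp add: nth_cycle_walk del: upt_Suc)
  have "(u, v) \<in> set (vwalk_arcs (cycle_walk l)) \<longleftrightarrow>
      (\<exists>i<l. u = cycle_walk l ! i \<and> v = cycle_walk l ! Suc i)"
    unfolding set_vwalk_arcs_nth by (auto simp del: upt_Suc)
  also have "\<dots> \<longleftrightarrow> (\<exists>i<l. u = i \<and> v = Suc i mod l)"
    using eq by (metis (no_types, lifting))
  finally show ?thesis by simp
qed

lemma gen_figure_8_loop_and_cycle:
  assumes "l > 0"
  shows "gen_figure_8 (loop_and_cycle l) 0"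
proof -
  define C where "C = {[0, 0], cycle_walk l}"
  have C: "circuit (loop_and_cycle l) p \<and> hd p = 0" if "p \<in> C" for p
    using that unfolding C_def circuits_at_0[OF assms, symmetric] by (rule CollectD)
  have meet: "set p \<inter> set q = {0}" if "p \<in> C" "q \<in> C" "p \<noteq> q" for p q
  proof -
    have "p = [0, 0] \<and> q = cycle_walk l \<or> q = [0, 0] \<and> p = cycle_walk l"
      using that unfolding C_def by (elim insertE emptyE) simp_all
    then show ?thesis by (elim disjE conjE) simp_all
  qed
  have arcs: "(\<Union>p\<in>C. set (vwalk_arcs p)) = parcs (loop_and_cycle l)"
  proof (rule set_eqI)
    fix a :: "nat \<times> nat"
    obtain u v where a: "a = (u, v)" by (cases a)
    have "a \<in> (\<Union>p\<in>C. set (vwalk_arcs p)) \<longleftrightarrow>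
        (u, v) = (0, 0) \<or> (u, v) \<in> set (vwalk_arcs (cycle_walk l))"
      unfolding a C_def by (simp del: upt_Suc)
    also have "\<dots> \<longleftrightarrow> a \<in> parcs (loop_and_cycle l)"
      unfolding vwalk_arcs_cycle_walk[OF assms] a loop_and_cycle_simps using assms by auto
    finally show "a \<in> (\<Union>p\<in>C. set (vwalk_arcs p)) \<longleftrightarrow> a \<in> parcs (loop_and_cycle l)" .
  qed
  have "0 \<in> pverts (loop_and_cycle l)" using assms by simp
  then show ?thesis
    unfolding gen_figure_8_def using C meet arcs by (intro conjI exI[of _ C] ballI impI) simp_all
qed

lemma unique_circuit_length_1:
  assumes "l \<ge> 2"
  shows "\<exists>!p. circuit (loop_and_cycle l) p \<and> vwalk_length p = 1"
proof (rule ex1I[of _ "[0, 0]"])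
  show "circuit (loop_and_cycle l) [0, 0] \<and> vwalk_length [0, 0] = 1"
    using circuit_loop assms by simp
next
  fix p assume p: "circuit (loop_and_cycle l) p \<and> vwalk_length p = 1"
  then have "length p - 1 = 1" by (simp only: vwalk_length_simp)
  then have "length p = 2" by arith
  then obtain a b where ab: "p = [a, b]"
    by (auto simp: numeral_2_eq_2 length_Suc_conv)
  have "(a, a) \<in> parcs (loop_and_cycle l)" "a = b"
    using p ab by (auto simp: circuit_def vwalk_with_proj_iff)
  then show "p = [0, 0]"
    using ab assms by (cases "Suc a = l") auto
qed

section \<open>Towers of such graphs\<close>

primrec len :: "(nat \<Rightarrow> nat) \<Rightarrow> nat \<Rightarrow> nat" where
  "len s 0 = 1"
| "len s (Suc n) = 2 * s n + 4 * len s n"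

text \<open>The vertex map of the projection that wraps the long cycle as
\<open>loop^s cycle^4 loop^s\<close> around the short graph.\<close>

definition bond :: "(nat \<Rightarrow> nat) \<Rightarrow> nat \<Rightarrow> nat \<Rightarrow> nat" where
  "bond s n j = (if s n \<le> j \<and> j < s n + 4 * len s n then (j - s n) mod len s n else 0)"

definition tower_graph :: "(nat \<Rightarrow> nat) \<Rightarrow> nat \<Rightarrow> nat pair_pre_digraph" where
  "tower_graph s n = loop_and_cycle (len s n)"

definition tower_map :: "(nat \<Rightarrow> nat) \<Rightarrow> nat \<Rightarrow> nat \<Rightarrow> nat" where
  "tower_map s m = bond s (m - 1)"

lemma tower_map_Suc [simp]: "tower_map s (Suc n) = bond s n"
  by (simp add: tower_map_def)

lemma len_pos [simp]: "len s n > 0"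
  by (induction n) auto

lemma bond_less: "bond s n j < len s n"
  by (simp add: bond_def)

lemma bond_block: "k < 4 \<Longrightarrow> i < len s n \<Longrightarrow> bond s n (s n + k * len s n + i) = i"
proof -
  assume "k < 4" "i < len s n"
  then have "k * len s n + i < Suc k * len s n" "Suc k * len s n \<le> 4 * len s n"
    using mult_le_mono1[of "Suc k" 4 "len s n"] by simp_all
  then have "k * len s n + i < 4 * len s n"
    by linarith
  then show ?thesis
    using \<open>i < len s n\<close> by (simp add: bond_def)
qed

lemma bond_first_block: "u \<le> len s n \<Longrightarrow> bond s n (s n + u) = u mod len s n"
proof -
  assume "u \<le> len s n"
  then have "u < 4 * len s n" using len_pos[of s n] by linarith
  then show ?thesis by (simp add: bond_def)
qed

lemma bond_pos_cases:
  assumes "bond s n j = i" "i > 0"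
  obtains k where "k < 4" "j = s n + k * len s n + i"
proof -
  have j: "s n \<le> j" "j - s n < 4 * len s n" "i = (j - s n) mod len s n"
    using assms by (auto simp: bond_def split: if_splits)
  then have "(j - s n) div len s n < 4"
    by (simp add: div_less_iff_less_mult)
  moreover have "j = s n + (j - s n) div len s n * len s n + i"
    using j div_mult_mod_eq[of "j - s n" "len s n"] by linarith
  ultimately show thesis using that by blast
qed

text \<open>Consecutive blocks fit together because the last vertex of the cycle is followed by the center,
where the next block, or the final run of loops, begins.\<close>

lemma bond_Suc:
  "bond s n (Suc j) = Suc (bond s n j) mod len s n \<or> bond s n j = 0 \<and> bond s n (Suc j) = 0"
proof -
  consider "Suc j \<le> s n" | "s n \<le> j" "Suc j < s n + 4 * len s n"
    | "Suc j = s n + 4 * len s n" | "j \<ge> s n + 4 * len s n"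
    by linarith
  then show ?thesis
  proof cases
    case 1
    then show ?thesis by (auto simp: bond_def)
  next
    case 2
    then show ?thesis by (simp add: bond_def Suc_diff_le mod_Suc_eq)
  next
    case 3
    then have "Suc (j - s n) = 4 * len s n" "s n \<le> j"
      using len_pos[of s n] by linarith+
    moreover have "bond s n (Suc j) = 0"
      using 3 by (simp add: bond_def)
    moreover have "bond s n j = (j - s n) mod len s n"
      using 3 \<open>s n \<le> j\<close> by (simp add: bond_def)
    ultimately show ?thesis by (simp add: mod_Suc_eq)
  next
    case 4
    then show ?thesis by (auto simp: bond_def)
  qed
qed

lemma map_bond_blocks:
  "map (bond s n) ([0..<len s (Suc n)]) =
     replicate (s n) 0 @ [0..<len s n] @ [0..<len s n] @ [0..<len s n] @ [0..<len s n] @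
     replicate (s n) 0"
proof -
  let ?L = "len s n"
  let ?S = "s n"
  have block: "map (bond s n) [?S + k * ?L..<?S + k' * ?L] = [0..<?L]"
    if "k < 4" "k' = Suc k" for k k'
    using that by (intro nth_equalityI) (simp_all add: bond_block)
  have join: "[a..<b] @ [b..<c] = [a..<c]" if "a \<le> b" "b \<le> c" for a b c :: nat
    using that upt_add_eq_append[of a b "c - b"] by simp
  have split: "[0..<len s (Suc n)] = [0..<?S] @ [?S..<?S + 1 * ?L] @ [?S + 1 * ?L..<?S + 2 * ?L] @
      [?S + 2 * ?L..<?S + 3 * ?L] @ [?S + 3 * ?L..<?S + 4 * ?L] @ [?S + 4 * ?L..<len s (Suc n)]"
    using len_pos[of s n] by (simp add: join)
  have first: "map (bond s n) [0..<?S] = replicate ?S 0"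
    by (intro nth_equalityI) (simp_all add: bond_def)
  have last: "map (bond s n) [?S + 4 * ?L..<len s (Suc n)] = replicate ?S 0"
    by (intro nth_equalityI) (simp_all add: bond_def)
  have "map (bond s n) [?S..<?S + 1 * ?L] = [0..<?L]"
    using block[of 0 1] by simp
  moreover have "map (bond s n) [?S + 1 * ?L..<?S + 2 * ?L] = [0..<?L]"
    "map (bond s n) [?S + 2 * ?L..<?S + 3 * ?L] = [0..<?L]"
    "map (bond s n) [?S + 3 * ?L..<?S + 4 * ?L] = [0..<?L]"
    by (rule block; simp)+
  ultimately show ?thesis
    unfolding split map_append first last by (simp only:)
qed

lemma vwalk_power_loop: "vwalk_power [0, 0] k = replicate (Suc k) (0::nat)"
  by (induction k) (auto simp: vwalk_join_def)

lemma vwalk_power_cycle_walk: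
  assumes "l > 0"
  shows "vwalk_power (cycle_walk l) 4 = [0..<l] @ [0..<l] @ [0..<l] @ [0..<l] @ [0]"
proof -
  have "hd (cycle_walk l) = 0" "[0..<l] = 0 # [Suc 0..<l]"
    using assms by (simp_all add: hd_append upt_conv_Cons)
  then show ?thesis
    by (simp add: numeral_eq_Suc vwalk_join_def del: upt_Suc)
qed

text \<open>Divisibility by 3 is what makes the phase of the next section well defined. The value at 0 only
fixes the length of the first cycle: with it the recursion for \<open>len\<close> gives 6, a multiple
of 3, from the one-vertex graph at the bottom.\<close>

locale tower =
  fixes s :: "nat \<Rightarrow> nat"
  assumes s_0: "s 0 = 1"
    and s_pos: "s n > 0"
    and dvd_s: "n \<ge> 1 \<Longrightarrow> 3 dvd s n"
begin

lemma len_Suc_0: "len s (Suc 0) = 6"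
  by (simp add: s_0)

lemma len_ge_6: "n \<ge> 1 \<Longrightarrow> len s n \<ge> 6"
proof (induction n rule: dec_induct)
  case base
  then show ?case by (simp add: s_0)
next
  case (step n)
  then show ?case by simp
qed

lemma dvd_len: "n \<ge> 1 \<Longrightarrow> 3 dvd len s n"
proof (induction n rule: dec_induct)
  case base
  then show ?case by (simp add: s_0)
next
  case (step n)
  then show ?case using dvd_s[of n] by simp
qed

lemma bond_0: "bond s n 0 = 0"
  using s_pos[of n] by (simp add: bond_def)

lemma bond_1: "bond s n (Suc 0) = 0"
  using s_pos[of n] by (auto simp: bond_def)

lemma bond_last: "bond s n (len s (Suc n) - Suc 0) = 0"
proof -
  have "\<not> len s (Suc n) - Suc 0 < s n + 4 * len s n"
    using s_pos[of n] by simp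
  then show ?thesis by (simp only: bond_def if_False simp_thms)
qed

lemma bond_Suc_mod:
  assumes "j < len s (Suc n)"
  shows "bond s n (Suc j mod len s (Suc n)) = Suc (bond s n j) mod len s n \<or>
    bond s n j = 0 \<and> bond s n (Suc j mod len s (Suc n)) = 0"
proof (cases "Suc j = len s (Suc n)")
  case True
  then have "j = len s (Suc n) - Suc 0" by simp
  then have "bond s n j = 0" using bond_last by simp
  then show ?thesis using True by (simp add: bond_0 del: len.simps)
next
  case False
  then show ?thesis using assms bond_Suc[of s n j] by simp
qed

lemma cover_bond: "cover (bond s n) (tower_graph s (Suc n)) (tower_graph s n)"
  unfolding cover_def
proof (intro conjI)
  show hom: "graph_hom (bond s n) (tower_graph s (Suc n)) (tower_graph s n)"
    unfolding graph_hom_def tower_graph_def loop_and_cycle_simps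
    using bond_Suc_mod[of _ n] bond_less[of s n] bond_0 by (fastforce simp del: len.simps)
  show "edge_surjective (bond s n) (tower_graph s (Suc n)) (tower_graph s n)"
    unfolding edge_surjective_def
  proof (intro equalityI subsetI)
    fix e assume "e \<in> map_prod (bond s n) (bond s n) ` parcs (tower_graph s (Suc n))"
    then show "e \<in> parcs (tower_graph s n)"
      using hom unfolding graph_hom_def by auto
  next
    fix e assume e: "e \<in> parcs (tower_graph s n)"
    obtain u v where uv: "e = (u, v)" by (cases e)
    have "\<exists>a b. (a, b) \<in> parcs (tower_graph s (Suc n)) \<and> bond s n a = u \<and> bond s n b = v"
    proof (cases "u = 0 \<and> v = 0")
      case True
      then show ?thesis
        by (intro exI[of _ 0]) (simp add: tower_graph_def bond_0)
    next
      case False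
      then have u: "u < len s n" "v = Suc u mod len s n"
        using e uv by (auto simp: tower_graph_def)
      have "s n + Suc u < len s (Suc n)"
        using u s_pos[of n] len_pos[of s n] unfolding len.simps by linarith
      then show ?thesis
        using u bond_first_block[of u s n] bond_first_block[of "Suc u" s n]
        by (intro exI[of _ "s n + u"] exI[of _ "s n + Suc u"])
          (simp add: tower_graph_def del: len.simps)
    qed
    then show "e \<in> map_prod (bond s n) (bond s n) ` parcs (tower_graph s (Suc n))"
      using uv by force
  qed
  show "plus_directional (bond s n) (tower_graph s (Suc n))"
    using len_ge_6[of "Suc n"]
    by (auto simp: plus_directional_def tower_graph_def bond_0 bond_1 simp del: len.simps)
qed

text \<open>The center is the only vertex with two incoming edges; both of their sources, the center and the
end of the long cycle, lie over the center because the projection ends with a loop.\<close>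

lemma bidirectional_bond: "bidirectional (bond s n) (tower_graph s (Suc n))"
proof -
  have "bond s n u = bond s n u'"
    if "(u, v) \<in> parcs (tower_graph s (Suc n))" "(u', v) \<in> parcs (tower_graph s (Suc n))"
    for u u' v
  proof -
    have "w = v - 1" if "(w, v) \<in> parcs (tower_graph s (Suc n))" "v \<noteq> 0" for w
      using that by (cases "Suc w < len s (Suc n)")
        (auto simp: tower_graph_def not_less simp del: len.simps dest: antisym[OF Suc_leI])
    moreover have "bond s n w = 0" if "(w, 0) \<in> parcs (tower_graph s (Suc n))" for w
    proof (cases "Suc w = len s (Suc n)")
      case True
      then have "w = len s (Suc n) - Suc 0" by simp
      then show ?thesis using bond_last by simp
    next
      case False
      then have "Suc w < len s (Suc n)"
        using that by (simp add: tower_graph_def del: len.simps)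
      then have "w = 0" using that by (simp add: tower_graph_def del: len.simps)
      then show ?thesis by (simp add: bond_0)
    qed
    ultimately show ?thesis using that by (metis (full_types))
  qed
  then show ?thesis
    using cover_bond[of n] by (auto simp: bidirectional_def cover_def)
qed

lemma covering: "covering (tower_graph s) (tower_map s)"
proof -
  have "parcs (tower_graph s 0) = {(0, 0)}"
    by (auto simp: tower_graph_def)
  then show ?thesis
    using cover_bond unfolding covering_def
    by (auto simp: tower_graph_def cov_graph_loop_and_cycle)
qed

lemma two_circuit_covering: "two_circuit_covering (tower_graph s) (tower_map s) s s (\<lambda>_. 4)"
  unfolding two_circuit_covering_def
proof (intro conjI allI impI)
  show "bidirectional_covering (tower_graph s) (tower_map s)"
    using covering bidirectional_bond by (simp add: bidirectional_covering_def)
  show "proximal_covering (tower_graph s)"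
    unfolding proximal_covering_def
  proof (intro allI impI)
    fix n :: nat assume "n \<ge> 1"
    then have "len s n \<ge> 2" using len_ge_6[of n] by simp
    then show "\<exists>!p. circuit (tower_graph s n) p \<and> vwalk_length p = 1"
      unfolding tower_graph_def by (rule unique_circuit_length_1)
  qed
  show "\<exists>t t'. t \<ge> 2 \<and> t' \<ge> 2 \<and> (4::nat) = t + t'" for n :: nat
    by (intro exI[of _ 2]) simp
  show "\<exists>ctr e c. KR_covering (tower_graph s) (tower_map s) ctr \<and>
      (\<forall>n\<ge>1. {p. circuit (tower_graph s n) p \<and> hd p = ctr n} = {e n, c n} \<and> e n \<noteq> c n \<and>
        vwalk_length (e n) = 1) \<and>
      (\<forall>n\<ge>1. map (tower_map s (Suc n)) (c (Suc n)) =
        vwalk_power (e n) (s n) \<oplus> vwalk_power (c n) 4 \<oplus> vwalk_power (e n) (s n))"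
  proof (rule exI[of _ "\<lambda>_. 0"], rule exI[of _ "\<lambda>_. [0, 0]"],
      rule exI[of _ "\<lambda>n. cycle_walk (len s n)"], intro conjI allI impI)
    show "KR_covering (tower_graph s) (tower_map s) (\<lambda>_. 0)"
      using covering by (simp add: KR_covering_def tower_graph_def gen_figure_8_loop_and_cycle bond_0)
  next
    fix n :: nat assume "n \<ge> 1"
    then have "len s n \<ge> 6" by (rule len_ge_6)
    show "{p. circuit (tower_graph s n) p \<and> hd p = 0} = {[0, 0], cycle_walk (len s n)}"
      unfolding tower_graph_def by (rule circuits_at_0) simp
    have "length (cycle_walk (len s n)) \<noteq> length [0, 0]"
      using \<open>len s n \<ge> 6\<close> by simp
    then show "[0, 0] \<noteq> cycle_walk (len s n)" by metis
    show "vwalk_length [0, 0] = 1" by simp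
    have "map (bond s n) (cycle_walk (len s (Suc n))) =
        replicate (s n) 0 @ [0..<len s n] @ [0..<len s n] @ [0..<len s n] @ [0..<len s n] @
        replicate (s n) 0 @ [0]"
      unfolding map_append map_bond_blocks by (simp add: bond_0)
    moreover have "replicate (s n) 0 @ [0] = (0::nat) # replicate (s n) 0"
      by (simp add: replicate_append_same)
    moreover have "[0..<len s n] = 0 # [Suc 0..<len s n]"
      by (simp add: upt_conv_Cons)
    ultimately show "map (tower_map s (Suc n)) (cycle_walk (len s (Suc n))) =
        vwalk_power [0, 0] (s n) \<oplus> vwalk_power (cycle_walk (len s n)) 4 \<oplus>
        vwalk_power [0, 0] (s n)"
      unfolding vwalk_power_cycle_walk[OF len_pos] vwalk_power_loop tower_map_Suc
      by (simp add: vwalk_join_def replicate_append_same)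
  qed
qed (use s_pos in auto)

end

section \<open>The phase obstructs weak mixing\<close>

context tower
begin

abbreviation X :: "(nat \<Rightarrow> nat) set" where
  "X \<equiv> inv_limit (tower_graph s) (tower_map s)"

abbreviation f :: "(nat \<Rightarrow> nat) \<Rightarrow> nat \<Rightarrow> nat" where
  "f \<equiv> inv_limit_map (tower_graph s) (tower_map s)"

lemma X_iff: "x \<in> X \<longleftrightarrow> (\<forall>n. x n < len s n) \<and> (\<forall>n. x n = bond s n (x (Suc n)))"
  by (simp add: inv_limit_def tower_graph_def)

lemma X_less: "x \<in> X \<Longrightarrow> x n < len s n"
  unfolding X_iff by blast

lemma X_bond: "x \<in> X \<Longrightarrow> bond s n (x (Suc n)) = x n"
  unfolding X_iff by (metis (no_types))

lemma f_in_X: "x \<in> X \<Longrightarrow> f x \<in> X"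
  and f_arc: "x \<in> X \<Longrightarrow> (x n, f x n) \<in> parcs (tower_graph s n)"
  unfolding inv_limit_map_def
  using theI'[OF inv_limit_map_ex1[OF covering]] by blast+

lemma funpow_f_in_X: "x \<in> X \<Longrightarrow> (f ^^ k) x \<in> X"
  by (induction k) (auto simp: f_in_X)

lemma f_eq: "x \<in> X \<Longrightarrow> f x n = bond s n (Suc (x (Suc n)) mod len s (Suc n))"
proof -
  assume x: "x \<in> X"
  have "plus_directional (bond s n) (tower_graph s (Suc n))"
    using cover_bond by (simp add: cover_def)
  moreover have "(x (Suc n), Suc (x (Suc n)) mod len s (Suc n)) \<in> parcs (tower_graph s (Suc n))"
    using X_less[OF x, of "Suc n"] by (simp add: tower_graph_def del: len.simps)
  ultimately have "bond s n (f x (Suc n)) = bond s n (Suc (x (Suc n)) mod len s (Suc n))"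
    using f_arc[OF x, of "Suc n"] unfolding plus_directional_def by blast
  then show ?thesis using X_bond[OF f_in_X[OF x]] by simp
qed

lemma f_from_pos: "x \<in> X \<Longrightarrow> x n > 0 \<Longrightarrow> f x n = Suc (x n) mod len s n"
  using f_arc[of x n] by (simp add: tower_graph_def)

lemma f_into_pos:
  assumes "x \<in> X" "f x n = Suc i"
  shows "x n = i"
  using f_arc[OF assms(1), of n] assms(2) X_less[OF assms(1), of n]
  by (cases "Suc (x n) = len s n") (auto simp: tower_graph_def)

text \<open>A point that is away from the center at some level sits strictly inside a block one level up, so
it cannot return to the center there at the next step.\<close>

lemma pos_step:
  assumes x: "x \<in> X" and "x n > 0"
  shows "f x (Suc n) = Suc (x (Suc n))"
proof -
  have "bond s n (x (Suc n)) > 0" using X_bond[OF x] assms(2) by simp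
  then have "x (Suc n) \<noteq> 0" "x (Suc n) \<noteq> len s (Suc n) - Suc 0"
    using bond_0 bond_last by (metis less_irrefl)+
  then show ?thesis
    using f_from_pos[OF x, of "Suc n"] X_less[OF x, of "Suc n"] by (simp del: len.simps)
qed

lemma pos_Suc: "x \<in> X \<Longrightarrow> x n > 0 \<Longrightarrow> x (Suc n) > 0"
  using X_bond[of x n] bond_0[of n] by (metis gr0I less_irrefl)

text \<open>The phase of a point: its coordinates modulo 3 agree at all levels where they are away from the
center, since all blocks begin at multiples of 3.\<close>

lemma phase_Suc:
  assumes x: "x \<in> X" and "x n > 0" "n \<ge> 1"
  shows "x (Suc n) mod 3 = x n mod 3"
proof -
  obtain k where "x (Suc n) = s n + k * len s n + x n"
    using bond_pos_cases[OF X_bond[OF x] assms(2)] by blast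
  moreover obtain a b where "s n = 3 * a" "len s n = 3 * b"
    using dvd_s[OF assms(3)] dvd_len[OF assms(3)] by (auto elim!: dvdE)
  ultimately have "x (Suc n) = x n + 3 * (a + k * b)"
    by (simp add: algebra_simps)
  then show ?thesis by (simp only: mod_mult_self2)
qed

lemma phase_add:
  assumes "x \<in> X" "x 1 > 0"
  shows "x (1 + k) > 0 \<and> x (1 + k) mod 3 = x 1 mod 3"
  by (induction k) (use assms pos_Suc phase_Suc in auto)

text \<open>Each step may bring the point to the center at the current level, but never at the next one;
climbing one level per step keeps the coordinate positive and makes it advance by exactly 1.\<close>

lemma phase_funpow:
  assumes "x \<in> X" "x 1 > 0"
  shows "(f ^^ k) x (1 + k) > 0 \<and> (f ^^ k) x (1 + k) mod 3 = (x 1 + k) mod 3"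
proof (induction k)
  case 0
  then show ?case using assms by simp
next
  case (Suc k)
  let ?y = "(f ^^ k) x"
  have y: "?y \<in> X" using assms(1) by (rule funpow_f_in_X)
  have "f ?y (Suc (1 + k)) = Suc (?y (Suc (1 + k)))"
    using pos_step[OF y] Suc by simp
  moreover have "?y (Suc (1 + k)) mod 3 = (x 1 + k) mod 3"
    using phase_Suc[OF y, of "1 + k"] Suc by simp
  ultimately show ?case by (simp add: mod_Suc)
qed

lemma phase_return:
  assumes "x \<in> X" "x 1 > 0" "(f ^^ k) x 1 > 0"
  shows "(f ^^ k) x 1 mod 3 = (x 1 + k) mod 3"
  using phase_funpow[OF assms(1,2), of k] phase_add[OF funpow_f_in_X[OF assms(1)] assms(3), of k]
  by simp

text \<open>Placing the vertex always in the first block of the next level gives the thread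
\<open>x (n + 1) = s n + x n\<close> through any vertex of the first cycle.\<close>

lemma exists_point:
  assumes "i < 6"
  shows "\<exists>x\<in>X. x 1 = i"
proof
  define x where "x n = (if n = 0 then 0 else i + sum s {1..<n})" for n
  have step: "x (Suc n) = s n + x n" if "n \<ge> 1" for n
    using that by (simp add: x_def)
  have less: "x n < len s n" for n
  proof (induction n)
    case (Suc n)
    then show ?case
      using assms step[of n] by (cases "n = 0") (simp_all add: x_def s_0)
  qed (simp add: x_def)
  have "x n = bond s n (x (Suc n))" for n
  proof (cases "n = 0")
    case True
    then show ?thesis using bond_less[of s 0 "x 1"] by (simp add: x_def)
  next
    case False
    then show ?thesis using bond_first_block[of "x n" s n] less[of n] step[of n] by simp
  qed
  then show "x \<in> X" using less unfolding X_iff by blast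
  show "x 1 = i" by (simp add: x_def)
qed

lemma open_coordinate: "open {x :: nat \<Rightarrow> nat. x n = i}"
proof -
  have "open ((\<lambda>x :: nat \<Rightarrow> nat. x n) -` {i})"
    by (intro open_vimage discrete_topology_class.open_discrete continuous_on_product_coordinates)
  then show ?thesis by (simp add: vimage_def)
qed

text \<open>Along the orbit of a pair both phases advance together, so their difference never changes. A
dense orbit would have to visit pairs of vertices of the first cycle with different phase
differences, here (1, 1) and (1, 2).\<close>

lemma not_weakly_mixing: "\<not> weakly_mixing X f"
proof
  assume "weakly_mixing X f"
  then obtain z where z: "z \<in> X \<times> X"
    and dense: "X \<times> X \<subseteq> closure {(map_prod f f ^^ n) z |n. True}"
    unfolding weakly_mixing_def topologically_transitive_def by blast
  obtain x y where xy: "z = (x, y)" "x \<in> X" "y \<in> X" using z by blast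
  have pow: "(map_prod f f ^^ n) z = ((f ^^ n) x, (f ^^ n) y)" for n
    by (induction n) (simp_all add: xy(1))
  have visit: "\<exists>n. (f ^^ n) x 1 = i \<and> (f ^^ n) y 1 = j" if less: "i < 6" "j < 6" for i j
  proof -
    obtain u v where "u \<in> X" "v \<in> X" "u 1 = i" "v 1 = j"
      using exists_point[OF less(1)] exists_point[OF less(2)] by blast
    then have "({x. x 1 = i} \<times> {x. x 1 = j}) \<inter> closure {(map_prod f f ^^ n) z |n. True} \<noteq> {}"
      using dense by blast
    moreover have op: "open ({x :: nat \<Rightarrow> nat. x 1 = i} \<times> {x :: nat \<Rightarrow> nat. x 1 = j})"
      by (intro open_Times open_coordinate)
    ultimately have "({x. x 1 = i} \<times> {x. x 1 = j}) \<inter> {(map_prod f f ^^ n) z |n. True} \<noteq> {}"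
      by (simp only: open_Int_closure_eq_empty[OF op] not_False_eq_True)
    then show ?thesis by (auto simp: pow)
  qed
  obtain a where a: "(f ^^ a) x 1 = 1" "(f ^^ a) y 1 = 1" using visit[of 1 1] by auto
  obtain b where b: "(f ^^ b) x 1 = 1" "(f ^^ b) y 1 = 2" using visit[of 1 2] by auto
  have return: "(f ^^ (m + k)) w 1 mod 3 = ((f ^^ m) w 1 + k) mod 3"
    if "w \<in> X" "(f ^^ m) w 1 > 0" "(f ^^ (m + k)) w 1 > 0" for w m k
  proof -
    have "(f ^^ (m + k)) w = (f ^^ k) ((f ^^ m) w)"
      unfolding add.commute[of m k] by (simp only: funpow_add o_apply)
    then show ?thesis
      using phase_return[OF funpow_f_in_X[OF that(1)], of m k] that by simp
  qed
  show False
  proof (cases "a \<le> b")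
    case True
    then obtain k where k: "b = a + k" by (rule less_eqE)
    have "1 mod 3 = (1 + k) mod 3"
      using return[OF xy(2), of a k] unfolding a b[unfolded k] by (simp only: zero_less_one)
    moreover have "2 mod 3 = (1 + k) mod 3"
      using return[OF xy(3), of a k] unfolding a b[unfolded k]
      by (simp only: zero_less_one zero_less_numeral)
    ultimately have "(1::nat) mod 3 = 2 mod 3" by (rule trans[OF _ sym])
    then show False by simp
  next
    case False
    then have "b \<le> a" by simp
    then obtain k where k: "a = b + k" by (rule less_eqE)
    have "1 mod 3 = (1 + k) mod 3"
      using return[OF xy(2), of b k] unfolding b a[unfolded k] by (simp only: zero_less_one)
    moreover have "1 mod 3 = (2 + k) mod 3"
      using return[OF xy(3), of b k] unfolding b a[unfolded k]
      by (simp only: zero_less_one zero_less_numeral)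
    ultimately show False by (simp add: mod_Suc split: if_splits)
  qed
qed

end

section \<open>Invariant and ergodic measures\<close>

context tower
begin

abbreviation cyl :: "nat \<Rightarrow> nat \<Rightarrow> (nat \<Rightarrow> nat) set" where
  "cyl n i \<equiv> {x \<in> X. x n = i}"

abbreviation BX :: "(nat \<Rightarrow> nat) measure" where
  "BX \<equiv> restrict_space borel X"

abbreviation fixpt :: "nat \<Rightarrow> nat" where
  "fixpt \<equiv> (\<lambda>_. 0)"

lemma cyl_ge_len: "i \<ge> len s n \<Longrightarrow> cyl n i = {}"
  using X_less[of _ n] by (auto simp: not_le[symmetric])

lemma coordinate_measurable: "(\<lambda>x. x n) \<in> borel_measurable BX"
  by (intro measurable_restrict_space1 measurable_product_coordinates)

lemma cyl_sets: "cyl n i \<in> sets BX"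
proof -
  have "(\<lambda>x. x n) -` {i} \<inter> space BX \<in> sets BX"
    by (rule measurable_sets[OF coordinate_measurable]) (simp add: borel_open discrete_topology_class.open_discrete)
  moreover have "(\<lambda>x. x n) -` {i} \<inter> space BX = cyl n i"
    by (auto simp: space_restrict_space)
  ultimately show ?thesis by simp
qed

lemma f_measurable: "f \<in> BX \<rightarrow>\<^sub>M BX"
proof (rule measurable_restrict_space2)
  show "f \<in> space BX \<rightarrow> X"
    by (auto simp: space_restrict_space f_in_X)
  have "(\<lambda>x n. bond s n (Suc (x (Suc n)) mod len s (Suc n))) \<in> borel_measurable BX"
  proof (rule measurable_coordinatewise_then_product)
    fix n
    show "(\<lambda>x. bond s n (Suc (x (Suc n)) mod len s (Suc n))) \<in> borel_measurable BX"
      by (rule measurable_compose[OF coordinate_measurable[of "Suc n"]])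
        (simp add: measurable_cong_sets[OF sets_borel_eq_count_space refl])
  qed
  moreover have "f x = (\<lambda>n. bond s n (Suc (x (Suc n)) mod len s (Suc n)))" if "x \<in> space BX" for x
    using that f_eq by (auto simp: space_restrict_space simp del: len.simps)
  ultimately show "f \<in> borel_measurable BX"
    by (subst measurable_cong) auto
qed

lemma coordinate_determines_lower:
  assumes "x \<in> X" "y \<in> X" "n \<le> m" "x m = y m"
  shows "x n = y n"
  using assms(3,4)
proof (induction rule: inc_induct)
  case (step k)
  then show ?case using X_bond[OF assms(1), of k] X_bond[OF assms(2), of k] by simp
qed

text \<open>The cylinders over single coordinates generate the Borel sets because every coordinate takes
only countably many values.\<close>

lemma sets_BX: "sets BX = sigma_sets X (insert {} (range (\<lambda>(n, i). cyl n i)))"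
  (is "_ = sigma_sets X ?E")
proof (intro equalityI)
  have "?E \<subseteq> sets BX"
    using cyl_sets by auto
  from sets.sigma_sets_subset[OF this] show "sigma_sets X ?E \<subseteq> sets BX"
    by (simp add: space_restrict_space)
  let ?S = "sigma X ?E"
  have E: "?E \<subseteq> Pow X" by auto
  have coord: "(\<lambda>x. x n) \<in> borel_measurable ?S" for n :: nat
  proof -
    have "(\<lambda>x. x n) -` {i} \<inter> space ?S \<in> sets ?S" for i
    proof -
      have "(\<lambda>x. x n) -` {i} \<inter> space ?S = cyl n i"
        using E by (auto simp: space_measure_of)
      then show ?thesis
        using E by (auto simp: sets_measure_of intro!: sigma_sets.Basic)
    qed
    then show ?thesis
      unfolding measurable_cong_sets[OF refl sets_borel_eq_count_space]
      by (subst measurable_count_space_eq2_countable) auto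
  qed
  have id: "(\<lambda>x. x) \<in> ?S \<rightarrow>\<^sub>M BX"
    by (intro measurable_restrict_space2 measurable_coordinatewise_then_product coord)
      (use E in \<open>auto simp: space_measure_of\<close>)
  have "A \<in> sets ?S" if "A \<in> sets BX" for A
  proof -
    have "(\<lambda>x. x) -` A \<inter> space ?S = A"
      using E sets.sets_into_space[OF that] by (auto simp: space_measure_of space_restrict_space)
    then show ?thesis using measurable_sets[OF id that] by simp
  qed
  then show "sets BX \<subseteq> sigma_sets X ?E"
    using E by (auto simp: sets_measure_of)
qed

text \<open>A coordinate determines all lower ones, so two cylinders are nested or disjoint.\<close>

lemma Int_stable_cyl: "Int_stable (insert {} (range (\<lambda>(n, i). cyl n i)))"
proof -
  have key: "cyl n i \<inter> cyl m j = {} \<or> cyl n i \<inter> cyl m j = cyl m j" if "n \<le> m" for n m i j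
  proof (cases "\<exists>x. x \<in> cyl n i \<inter> cyl m j")
    case True
    then obtain x where x: "x \<in> X" "x n = i" "x m = j" by auto
    have "y n = i" if "y \<in> cyl m j" for y
      using coordinate_determines_lower[OF x(1) _ \<open>n \<le> m\<close>, of y] that x by simp
    then show ?thesis by auto
  qed auto
  show ?thesis
    unfolding Int_stable_def
  proof (intro ballI)
    fix A B
    assume AB: "A \<in> insert {} (range (\<lambda>(n, i). cyl n i))" "B \<in> insert {} (range (\<lambda>(n, i). cyl n i))"
    then have "A \<inter> B = {} \<or> A \<inter> B = A \<or> A \<inter> B = B"
    proof (elim insertE)
      assume "A \<in> range (\<lambda>(n, i). cyl n i)" "B \<in> range (\<lambda>(n, i). cyl n i)"
      then obtain n i m j where eq: "A = cyl n i" "B = cyl m j" by auto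
      show ?thesis
        using key[of n m i j] key[of m n j i] unfolding eq Int_commute[of "cyl m j"]
        by (meson nat_le_linear)
    qed simp_all
    then show "A \<inter> B \<in> insert {} (range (\<lambda>(n, i). cyl n i))"
      using AB by (elim disjE) simp_all
  qed
qed

lemma cyl_0_eq: "cyl n 0 = X - (\<Union>i\<in>{1..<len s n}. cyl n i)"
  using X_less by (fastforce simp: Suc_le_eq)

lemma disjoint_cyl: "disjoint_family_on (cyl n) A"
  by (auto simp: disjoint_family_on_def)

lemma measure_cyl_0:
  assumes "prob_space M" "sets M = sets BX"
  shows "measure M (cyl n 0) = 1 - (\<Sum>i\<in>{1..<len s n}. measure M (cyl n i))"
proof -
  interpret prob_space M by fact
  have sp: "space M = X"
    using sets_eq_imp_space_eq[OF assms(2)] by (simp add: space_restrict_space)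
  have "measure M (\<Union>i\<in>{1..<len s n}. cyl n i) = (\<Sum>i\<in>{1..<len s n}. measure M (cyl n i))"
    by (rule finite_measure_finite_Union) (auto simp: assms(2) cyl_sets disjoint_cyl)
  moreover have "(\<Union>i\<in>{1..<len s n}. cyl n i) \<in> sets M"
    unfolding assms(2) using cyl_sets by (intro sets.finite_UN) auto
  ultimately show ?thesis
    unfolding cyl_0_eq using prob_compl[of "\<Union>i\<in>{1..<len s n}. cyl n i"] sp by simp
qed

text \<open>The cylinders over the center need not be compared: on each level they are the complement of the
remaining ones.\<close>

lemma measure_eqI_cyl:
  assumes "prob_space M" "sets M = sets BX" "prob_space N" "sets N = sets BX"
    and eq: "\<And>n i. 1 \<le> i \<Longrightarrow> i < len s n \<Longrightarrow> measure M (cyl n i) = measure N (cyl n i)"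
  shows "M = N"
proof -
  interpret M: prob_space M by fact
  interpret N: prob_space N by fact
  have meq: "measure M (cyl n i) = measure N (cyl n i)" for n i
  proof -
    consider "i = 0" | "1 \<le> i" "i < len s n" | "i \<ge> len s n" by linarith
    then show ?thesis
    proof cases
      case 1
      then show ?thesis
        using measure_cyl_0[OF assms(1,2), of n] measure_cyl_0[OF assms(3,4), of n] eq by simp
    next
      case 2
      then show ?thesis by (rule eq)
    next
      case 3
      then show ?thesis by (simp only: cyl_ge_len measure_empty)
    qed
  qed
  show ?thesis
  proof (rule measure_eqI_generator_eq[OF Int_stable_cyl, where \<Omega> = X and A = "\<lambda>_. cyl 0 0"])
    show "insert {} (range (\<lambda>(n, i). cyl n i)) \<subseteq> Pow X" by auto
    show "emeasure M A = emeasure N A" if "A \<in> insert {} (range (\<lambda>(n, i). cyl n i))" for A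
      using that meq by (auto simp: M.emeasure_eq_measure N.emeasure_eq_measure)
    show "sets M = sigma_sets X (insert {} (range (\<lambda>(n, i). cyl n i)))"
      "sets N = sigma_sets X (insert {} (range (\<lambda>(n, i). cyl n i)))"
      using assms sets_BX by simp_all
    show "range (\<lambda>_. cyl 0 0) \<subseteq> insert {} (range (\<lambda>(n, i). cyl n i))" by auto
    show "(\<Union>i. cyl 0 0) = X" using X_less[of _ 0] by auto
    show "emeasure M (cyl 0 0) \<noteq> \<infinity>" by simp
  qed
qed

lemma cyl_blocks:
  assumes "i > 0" "i < len s n"
  shows "cyl n i = (\<Union>k<4. cyl (Suc n) (s n + k * len s n + i))"
proof (intro equalityI subsetI)
  fix x assume x: "x \<in> cyl n i"
  then obtain k where "k < 4" "x (Suc n) = s n + k * len s n + i"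
    using bond_pos_cases[of s n "x (Suc n)" i] X_bond[of x n] assms by auto
  then show "x \<in> (\<Union>k<4. cyl (Suc n) (s n + k * len s n + i))" using x by auto
next
  fix x assume "x \<in> (\<Union>k<4. cyl (Suc n) (s n + k * len s n + i))"
  then obtain k where "k < 4" "x (Suc n) = s n + k * len s n + i" "x \<in> X" by auto
  then show "x \<in> cyl n i" using bond_block[of k i s n] X_bond[of x n] assms by simp
qed

lemma measure_blocks:
  assumes "prob_space M" "sets M = sets BX"
  shows "measure M (\<Union>k<4. cyl (Suc n) (s n + k * len s n + i)) =
    (\<Sum>k<4. measure M (cyl (Suc n) (s n + k * len s n + i)))"
proof -
  interpret prob_space M by fact
  show ?thesis
    by (rule finite_measure_finite_Union)
      (use len_pos[of s n] in \<open>auto simp: assms(2) cyl_sets disjoint_family_on_def simp del: len.simps len_pos\<close>)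
qed

lemma vimage_cyl_Suc:
  assumes "i > 0" "Suc i < len s n"
  shows "f -` cyl n (Suc i) \<inter> X = cyl n i"
  using assms f_into_pos[of _ n i] f_from_pos[of _ n] f_in_X by auto

lemma block_less: "k < 4 \<Longrightarrow> i < len s n \<Longrightarrow> s n + k * len s n + i < len s (Suc n)"
  using mult_le_mono1[of "Suc k" 4 "len s n"] s_pos[of n] unfolding len.simps mult_Suc by linarith

text \<open>The preimage of the first cylinder after the center (\<open>i = 0\<close>) is not a cylinder of the
same level, because the point may come from anywhere at the center. One level up the same set
splits into cylinders that are not next to the center, and there preimages are plain shifts.\<close>

lemma vimage_cyl:
  assumes "Suc i < len s n"
  shows "f -` cyl n (Suc i) \<inter> X = (\<Union>k<4. cyl (Suc n) (s n + k * len s n + i))"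
proof -
  have "f -` cyl n (Suc i) \<inter> X = (\<Union>k<4. f -` cyl (Suc n) (Suc (s n + k * len s n + i)) \<inter> X)"
    unfolding cyl_blocks[OF zero_less_Suc assms] by auto
  also have "\<dots> = (\<Union>k<4. cyl (Suc n) (s n + k * len s n + i))"
  proof (intro SUP_cong refl vimage_cyl_Suc)
    fix k :: nat assume "k \<in> {..<4}"
    then show "0 < s n + k * len s n + i" "Suc (s n + k * len s n + i) < len s (Suc n)"
      using s_pos[of n] block_less[of k "Suc i" n] assms by auto
  qed
  finally show ?thesis .
qed

lemma invariantI:
  assumes M: "prob_space M" "sets M = sets BX"
    and const: "\<And>n i j. 1 \<le> i \<Longrightarrow> i < len s n \<Longrightarrow> 1 \<le> j \<Longrightarrow> j < len s n \<Longrightarrow>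
      measure M (cyl n i) = measure M (cyl n j)"
  shows "invariant_measure X f M"
proof -
  interpret prob_space M by fact
  have sp: "space M = X"
    using sets_eq_imp_space_eq[OF M(2)] by (simp add: space_restrict_space)
  have fM: "f \<in> M \<rightarrow>\<^sub>M M"
    using f_measurable unfolding measurable_cong_sets[OF M(2) M(2)] .
  have "distr M M f = M"
  proof (rule measure_eqI_cyl)
    show "prob_space (distr M M f)" by (rule prob_space_distr[OF fM])
    fix n i assume i: "1 \<le> i" "i < len s n"
    then obtain j where j: "i = Suc j" by (cases i) auto
    have "measure (distr M M f) (cyl n i) = measure M (f -` cyl n i \<inter> X)"
      by (simp add: measure_distr fM M(2) cyl_sets sp)
    also have "\<dots> = (\<Sum>k<4. measure M (cyl (Suc n) (s n + k * len s n + j)))"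
      unfolding j using i j by (subst vimage_cyl) (simp_all add: measure_blocks[OF M] del: len.simps)
    also have "\<dots> = (\<Sum>k<4. measure M (cyl (Suc n) (s n + k * len s n + i)))"
    proof (intro sum.cong refl const)
      fix k :: nat assume "k \<in> {..<4}"
      then show "s n + k * len s n + j < len s (Suc n)" "s n + k * len s n + i < len s (Suc n)"
        using block_less[of k i n] block_less[of k j n] i j by (simp_all del: len.simps)
    qed (use s_pos[of n] in auto)
    also have "\<dots> = measure M (cyl n i)"
      using cyl_blocks[of i n] measure_blocks[OF M, of n i] i by simp
    finally show "measure (distr M M f) (cyl n i) = measure M (cyl n i)" .
  qed (use M in simp_all)
  then show ?thesis
    using M sp fM by (simp add: invariant_measure_def)
qed

lemma fixpt_in_X: "fixpt \<in> X"
  unfolding X_iff by (simp add: bond_0)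

lemma fixpt_eq_INT: "{fixpt} = (\<Inter>n. cyl (Suc n) 0)"
proof (intro equalityI subsetI)
  fix x assume x: "x \<in> (\<Inter>n. cyl (Suc n) 0)"
  then have "x \<in> X" "x (Suc n) = 0" for n by auto
  then have "x n = 0" for n using X_less[of x 0] by (cases n) auto
  then show "x \<in> {fixpt}" by auto
qed (use fixpt_in_X in auto)

lemma fixpt_sets: "{fixpt} \<in> sets BX"
  unfolding fixpt_eq_INT using cyl_sets by auto

context
  fixes M
  assumes inv: "invariant_measure X f M"
begin

lemma prob_M: "prob_space M" and sets_M: "sets M = sets BX" and space_M: "space M = X"
  and f_M: "f \<in> M \<rightarrow>\<^sub>M M"
  using inv by (simp_all add: invariant_measure_def)

interpretation prob_space M by (rule prob_M)

lemma emeasure_vimage: "A \<in> sets M \<Longrightarrow> emeasure M (f -` A \<inter> X) = emeasure M A"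
  using inv emeasure_distr[OF f_M, of A] by (simp add: invariant_measure_def)

lemma measure_cyl_const: "Suc i < len s n \<Longrightarrow> measure M (cyl n (Suc i)) = measure M (cyl n 1)"
proof (induction i)
  case (Suc i)
  have "measure M (cyl n (Suc (Suc i))) = measure M (f -` cyl n (Suc (Suc i)) \<inter> X)"
    using emeasure_vimage[of "cyl n (Suc (Suc i))"] by (simp add: sets_M cyl_sets measure_def)
  then show ?case using Suc vimage_cyl_Suc[of "Suc i" n] by simp
qed simp

text \<open>All vertices of a cycle carry the same mass, and a vertex of the cycle of level n is covered by
one vertex in each of the four blocks, so the masses drop by the factor 4. One number, the mass
of a vertex of the first cycle, therefore determines an invariant measure.\<close>

lemma measure_cyl:
  assumes "1 \<le> i" "i < len s (Suc n)"
  shows "measure M (cyl (Suc n) i) = measure M (cyl 1 1) / 4 ^ n"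
proof -
  have lift: "measure M (cyl n 1) = 4 * measure M (cyl (Suc n) 1)" if n: "n \<ge> 1" for n
  proof -
    have one: "1 < len s n" using len_ge_6[OF n] by simp
    have "measure M (cyl n 1) = (\<Sum>k<4. measure M (cyl (Suc n) (s n + k * len s n + 1)))"
      using cyl_blocks[OF _ one] measure_blocks[OF prob_M sets_M, of n 1] by simp
    also have "\<dots> = (\<Sum>k<(4::nat). measure M (cyl (Suc n) 1))"
      using measure_cyl_const block_less[OF _ one] by (intro sum.cong) auto
    finally show ?thesis by simp
  qed
  have "measure M (cyl (Suc n) 1) = measure M (cyl 1 1) / 4 ^ n"
  proof (induction n)
    case (Suc n)
    then show ?case using lift[of "Suc n"] by simp
  qed simp
  then show ?thesis
    using measure_cyl_const[of "i - 1" "Suc n"] assms by simp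
qed

lemma measure_cyl_0_inv:
  "measure M (cyl (Suc n) 0) = 1 - (real (len s (Suc n)) - 1) / 4 ^ n * measure M (cyl 1 1)"
proof -
  have "(\<Sum>i\<in>{1..<len s (Suc n)}. measure M (cyl (Suc n) i)) =
      (\<Sum>i\<in>{1..<len s (Suc n)}. measure M (cyl 1 1) / 4 ^ n)"
    by (intro sum.cong refl measure_cyl) (simp_all only: atLeastLessThan_iff)
  also have "\<dots> = (real (len s (Suc n)) - 1) / 4 ^ n * measure M (cyl 1 1)"
    using len_pos[of s "Suc n"] by (simp add: of_nat_diff Suc_le_eq del: len.simps)
  finally show ?thesis
    using measure_cyl_0[OF prob_M sets_M, of "Suc n"] by simp
qed

lemma measure_cyl_0_tendsto: "(\<lambda>n. measure M (cyl (Suc n) 0)) \<longlonglongrightarrow> measure M {fixpt}"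
  unfolding fixpt_eq_INT
proof (rule finite_Lim_measure_decseq)
  show "range (\<lambda>n. cyl (Suc n) 0) \<subseteq> sets M" using cyl_sets sets_M by auto
  show "decseq (\<lambda>n. cyl (Suc n) 0)"
    unfolding decseq_Suc_iff using pos_Suc by fastforce
qed

end

lemma invariant_unique:
  assumes M: "invariant_measure X f M" and N: "invariant_measure X f N"
    and "measure M (cyl 1 1) = measure N (cyl 1 1)"
  shows "M = N"
proof (rule measure_eqI_cyl)
  show "prob_space M" "sets M = sets BX" "prob_space N" "sets N = sets BX"
    using M N by (simp_all add: invariant_measure_def)
  fix n i assume "1 \<le> i" "i < len s n"
  then show "measure M (cyl n i) = measure N (cyl n i)"
    using measure_cyl[OF M] measure_cyl[OF N] assms(3) by (cases n) (simp_all del: len.simps(2))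
qed

text \<open>The cylinders over the center shrink to the fixed point. If that point has no mass, the total mass
of the cycle of level n tends to 1, and this total is a known constant times the mass of a
vertex of the first cycle.\<close>

lemma nonatomic_unique:
  assumes M: "invariant_measure X f M" and N: "invariant_measure X f N"
    and "measure M {fixpt} = 0" "measure N {fixpt} = 0"
  shows "M = N"
proof (rule invariant_unique[OF M N])
  define c where "c n = (real (len s (Suc n)) - 1) / 4 ^ n" for n
  have lim: "(\<lambda>n. c n * measure K (cyl 1 1)) \<longlonglongrightarrow> 1"
    if K: "invariant_measure X f K" and null: "measure K {fixpt} = 0" for K
  proof -
    have "(\<lambda>n. 1 - c n * measure K (cyl 1 1)) \<longlonglongrightarrow> 0"
      using measure_cyl_0_tendsto[OF K] unfolding measure_cyl_0_inv[OF K] c_def null .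
    from tendsto_diff[OF tendsto_const[of 1] this] show ?thesis by simp
  qed
  \<comment> \<open>With both limits 1, the common sequence \<open>c n * a * b\<close> tends to a and to b.\<close>
  let ?a = "measure M (cyl 1 1)" and ?b = "measure N (cyl 1 1)"
  have "(\<lambda>n. ?b * (c n * ?a)) \<longlonglongrightarrow> ?b * 1" "(\<lambda>n. ?a * (c n * ?b)) \<longlonglongrightarrow> ?a * 1"
    by (intro tendsto_mult_left lim M N assms(3,4))+
  moreover have "(\<lambda>n. ?b * (c n * ?a)) = (\<lambda>n. ?a * (c n * ?b))"
    by (simp add: mult_ac)
  ultimately show "?a = ?b"
    using LIMSEQ_unique[of "\<lambda>n. ?a * (c n * ?b)" "?a * 1" "?b * 1"] by simp
qed

lemma f_eq_fixpt_iff: "x \<in> X \<Longrightarrow> f x = fixpt \<longleftrightarrow> x = fixpt"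
proof
  assume x: "x \<in> X" "f x = fixpt"
  show "x = fixpt"
  proof
    fix n
    show "x n = 0" using pos_step[OF x(1), of n] x(2) by (cases "x n") auto
  qed
next
  assume "x \<in> X" "x = fixpt"
  then have "f x n = 0" for n
    using f_eq[of x n] len_ge_6[of "Suc n"] bond_1[of n] by (simp del: len.simps)
  then show "f x = fixpt" by auto
qed

lemma vimage_fixpt: "f -` {fixpt} \<inter> X = {fixpt}"
  using f_eq_fixpt_iff fixpt_in_X by auto

lemma dirac_invariant: "invariant_measure X f (return BX fixpt)"
proof (rule invariantI)
  show "prob_space (return BX fixpt)"
    by (rule prob_space_return) (simp add: space_restrict_space fixpt_in_X)
  fix n i j :: nat assume "1 \<le> i" "1 \<le> j"
  then show "measure (return BX fixpt) (cyl n i) = measure (return BX fixpt) (cyl n j)"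
    by (simp add: measure_return cyl_sets)
qed simp

lemma dirac_cyl: "measure (return BX fixpt) (cyl 1 1) = 0"
  by (simp add: measure_return cyl_sets)

lemma dirac_ergodic: "ergodic_measure X f (return BX fixpt)"
  unfolding ergodic_measure_def using dirac_invariant
  by (auto simp: measure_return indicator_def)

text \<open>Conditioning on an invariant set of positive measure gives an invariant measure that again does
not charge the fixed point, hence the same measure; so the set has full measure.\<close>

lemma nonatomic_ergodic:
  assumes M: "invariant_measure X f M" and "measure M {fixpt} = 0"
  shows "ergodic_measure X f M"
  unfolding ergodic_measure_def
proof (intro conjI M ballI impI)
  fix A assume A: "A \<in> sets M" "f -` A \<inter> space M = A"
  interpret prob_space M by (rule prob_M[OF M])
  note sp = space_M[OF M] and fM = f_M[OF M]
  show "measure M A = 0 \<or> measure M A = 1"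
  proof (cases "measure M A = 0")
    case False
    then have pos: "emeasure M A \<noteq> 0" by (simp add: emeasure_eq_measure)
    let ?N = "uniform_measure M A"
    have N: "prob_space ?N"
      by (rule prob_space_uniform_measure) (simp_all add: pos)
    have "distr ?N ?N f = ?N"
    proof (rule measure_eqI)
      fix B assume "B \<in> sets (distr ?N ?N f)"
      then have B: "B \<in> sets M" by simp
      have vB: "f -` B \<inter> X \<in> sets M" using measurable_sets[OF fM B] sp by simp
      have "A \<inter> (f -` B \<inter> X) = f -` (A \<inter> B) \<inter> X"
        using A(2) sp by blast
      then have "emeasure M (A \<inter> (f -` B \<inter> X)) = emeasure M (A \<inter> B)"
        using emeasure_vimage[OF M, of "A \<inter> B"] A(1) B by simp
      moreover have "emeasure (distr ?N ?N f) B = emeasure ?N (f -` B \<inter> X)"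
        using emeasure_distr[of f ?N ?N B] fM B sp by simp
      ultimately show "emeasure (distr ?N ?N f) B = emeasure ?N B"
        using A(1) B vB by simp
    qed simp
    then have inv: "invariant_measure X f ?N"
      using N M fM by (simp add: invariant_measure_def)
    have "measure M (A \<inter> {fixpt}) \<le> measure M {fixpt}"
      using fixpt_sets sets_M[OF M] by (intro finite_measure_mono) auto
    then have "measure M (A \<inter> {fixpt}) = 0"
      using assms(2) measure_nonneg[of M "A \<inter> {fixpt}"] by linarith
    then have "measure ?N {fixpt} = 0"
      using measure_uniform_measure[OF pos, of "{fixpt}"] fixpt_sets sets_M[OF M] by simp
    then have "?N = M" using nonatomic_unique[OF inv M] assms(2) by simp
    moreover have "measure ?N A = 1"
      using measure_uniform_measure[OF pos _ A(1)] False by simp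
    ultimately show ?thesis by simp
  qed simp
qed

text \<open>The fixed point forms an invariant set, because no other point is mapped to it. Ergodicity gives
it mass 0 or 1.\<close>

lemma ergodic_cases:
  assumes "ergodic_measure X f M"
  shows "M = return BX fixpt \<or> measure M {fixpt} = 0"
proof -
  have M: "invariant_measure X f M" using assms by (simp add: ergodic_measure_def)
  interpret prob_space M by (rule prob_M[OF M])
  note setsM = sets_M[OF M] and sp = space_M[OF M]
  have "measure M {fixpt} = 0 \<or> measure M {fixpt} = 1"
    using assms vimage_fixpt fixpt_sets setsM sp by (simp add: ergodic_measure_def)
  moreover have "M = return BX fixpt" if one: "measure M {fixpt} = 1"
  proof (rule invariant_unique[OF M dirac_invariant])
    have "measure M (cyl 1 1) \<le> measure M (space M - {fixpt})"
      using setsM fixpt_sets sets.compl_sets[of "{fixpt}" M] sp by (intro finite_measure_mono) auto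
    also have "\<dots> = 0"
      using prob_compl[of "{fixpt}"] one setsM fixpt_sets by simp
    finally show "measure M (cyl 1 1) = measure (return BX fixpt) (cyl 1 1)"
      using dirac_cyl measure_nonneg[of M "cyl 1 1"] by linarith
  qed
  ultimately show ?thesis by blast
qed

lemma two_ergodic_measures:
  assumes M: "invariant_measure X f M" and "measure M {fixpt} = 0"
  shows "card {M. ergodic_measure X f M} = 2"
proof -
  have "{N. ergodic_measure X f N} = {return BX fixpt, M}"
  proof (intro equalityI subsetI)
    fix N assume "N \<in> {N. ergodic_measure X f N}"
    then have N: "ergodic_measure X f N" by simp
    then have "measure N {fixpt} = 0 \<Longrightarrow> N = M"
      using nonatomic_unique[OF _ M _ assms(2)] by (simp add: ergodic_measure_def)
    then show "N \<in> {return BX fixpt, M}" using ergodic_cases[OF N] by blast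
  next
    fix N assume "N \<in> {return BX fixpt, M}"
    then show "N \<in> {N. ergodic_measure X f N}"
      using dirac_ergodic nonatomic_ergodic[OF assms] by (elim insertE) simp_all
  qed
  moreover have "measure (return BX fixpt) {fixpt} = 1"
    using fixpt_sets by (simp add: measure_return)
  ultimately show ?thesis using assms(2) by (auto simp: card_insert_if)
qed

end

section \<open>Growth conditions on the lengths\<close>

text \<open>The cycle of level \<open>n + 1\<close> has total mass at most 1, and this mass is about
\<open>len s (n + 1) / 4 ^ n\<close> times the mass of a vertex of the first cycle. If the cycles
grow faster than \<open>4 ^ n\<close>, that vertex has mass 0.\<close>

lemma (in tower) uniquely_ergodicI:
  assumes "(\<lambda>n. 4 ^ n / (real (len s (Suc n)) - 1)) \<longlonglongrightarrow> 0"
  shows "uniquely_ergodic X f"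
  unfolding uniquely_ergodic_def
proof (rule ex1I[of _ "return BX fixpt"])
  show "invariant_measure X f (return BX fixpt)" by (rule dirac_invariant)
next
  fix M assume M: "invariant_measure X f M"
  have "measure M (cyl 1 1) \<le> 4 ^ n / (real (len s (Suc n)) - 1)" for n
  proof -
    have "real (len s (Suc n)) - 1 > 0"
      using len_ge_6[of "Suc n"] by (simp del: len.simps)
    moreover have "(real (len s (Suc n)) - 1) / 4 ^ n * measure M (cyl 1 1) \<le> 1"
      using measure_cyl_0_inv[OF M, of n] measure_nonneg[of M "cyl (Suc n) 0"] by linarith
    ultimately show ?thesis by (simp add: field_simps del: len.simps)
  qed
  then have "measure M (cyl 1 1) \<le> 0"
    by (intro LIMSEQ_le_const[OF assms]) blast
  then have "measure M (cyl 1 1) = 0"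
    using measure_nonneg[of M "cyl 1 1"] by linarith
  then show "M = return BX fixpt"
    using invariant_unique[OF M dirac_invariant] dirac_cyl by simp
qed

text \<open>For \<open>n \<ge> 1\<close> the two runs of loops make up two thirds of the cycle above level n, and the
lengths grow by the factor 12 from level 1 on.\<close>

definition fast :: "nat \<Rightarrow> nat" where
  "fast n = (if n = 0 then 1 else 2 * 12 ^ n)"

text \<open>With 3 loops on either side the lengths are \<open>2 * 4 ^ n - 2\<close> for \<open>n \<ge> 1\<close>, of
the order of \<open>4 ^ n\<close>.\<close>

definition slow :: "nat \<Rightarrow> nat" where
  "slow n = (if n = 0 then 1 else 3)"

lemma slow_eq: "n \<noteq> 0 \<Longrightarrow> slow n = 3"
  by (simp add: slow_def)

interpretation fast: tower fast
proof
  show "3 dvd fast n" if "n \<ge> 1" for n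
    using that by (cases n) (simp_all add: fast_def)
qed (simp_all add: fast_def)

interpretation slow: tower slow
  by unfold_locales (simp_all add: slow_def)

lemma len_fast: "len fast (Suc n) = 6 * 12 ^ n"
proof (induction n)
  case (Suc n)
  then show ?case by (simp add: fast_def)
qed (simp add: fast_def)

lemma len_slow: "len slow (Suc n) + 2 = 2 * 4 ^ Suc n"
proof (induction n)
  case (Suc n)
  then show ?case by (simp add: slow_def)
qed (simp add: slow_def)

lemma fast_uniquely_ergodic: "uniquely_ergodic fast.X fast.f"
proof (rule fast.uniquely_ergodicI)
  have upper: "4 ^ n / (real (len fast (Suc n)) - 1) \<le> (1 / 3) ^ n" for n
  proof -
    have "(1::real) \<le> 12 ^ n" by simp
    then have "(12::real) ^ n \<le> 6 * 12 ^ n - 1" by linarith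
    then have "(4::real) ^ n / (6 * 12 ^ n - 1) \<le> 4 ^ n / 12 ^ n"
      by (intro divide_left_mono) (simp_all add: less_le_trans[OF zero_less_power])
    also have "\<dots> = (1 / 3) ^ n" by (simp flip: power_divide)
    finally show ?thesis unfolding len_fast by simp
  qed
  have lower: "0 \<le> 4 ^ n / (real (len fast (Suc n)) - 1)" for n
    using fast.len_ge_6[of "Suc n"] by (simp del: len.simps)
  show "(\<lambda>n. 4 ^ n / (real (len fast (Suc n)) - 1)) \<longlonglongrightarrow> 0"
    by (rule tendsto_sandwich[OF always_eventually always_eventually tendsto_const
          LIMSEQ_realpow_zero[of "1/3"]]) (use upper lower in auto)
qed

section \<open>A measure without atom at the fixed point\<close>

text \<open>On level n the unit interval is cut into \<open>2 * 4 ^ n\<close> equal pieces, and the points of piece u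
are sent to the vertex \<open>coding n u\<close>. For \<open>n \<ge> 1\<close> the pieces 0, 1, 2 go to the
center and every other vertex receives exactly one piece. The four parts of the piece of a vertex
go to the four copies of that vertex in the next cycle. The twelve parts of the three central
pieces go to the vertices above the center: three parts to the center itself and the others to
the nine vertices of the explicit list, namely the remaining vertices of the two runs of loops
and the starting points of the four blocks.\<close>

primrec coding :: "nat \<Rightarrow> nat \<Rightarrow> nat" where
  "coding 0 u = 0"
| "coding (Suc n) u =
     (let L = len slow n in
      if n = 0 then u - 2
      else if u < 3 then 0
      else if u < 12 then [1, 2, 3, 3 + L, 3 + 2 * L, 3 + 3 * L, 3 + 4 * L, 4 + 4 * L, 5 + 4 * L] ! (u - 3)
      else 3 + (u mod 4) * L + coding n (u div 4))"

lemma coding_small: "u < 3 \<Longrightarrow> coding n u = 0"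
  by (cases n) (simp_all add: Let_def)

lemma less_12_cases:
  fixes u :: nat
  assumes "3 \<le> u" "u < 12"
  obtains "u = 3" | "u = 4" | "u = 5" | "u = 6" | "u = 7" | "u = 8" | "u = 9" | "u = 10" | "u = 11"
  using assms by linarith

lemma coding_less: "u < 2 * 4 ^ n \<Longrightarrow> coding n u < len slow n"
proof (induction n arbitrary: u)
  case (Suc n)
  show ?case
  proof (cases "n = 0")
    case True
    then show ?thesis using Suc.prems by (simp add: slow_def)
  next
    case False
    consider "u < 3" | "3 \<le> u" "u < 12" | "u \<ge> 12" by linarith
    then show ?thesis
    proof cases
      case 1
      then show ?thesis by (simp add: coding_small del: coding.simps len.simps)
    next
      case 2
      then show ?thesis
        using len_pos[of slow n] False by (cases rule: less_12_cases) (auto simp: slow_eq)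
    next
      case 3
      have "u div 4 < 2 * 4 ^ n" using Suc.prems by (simp add: div_less_iff_less_mult mult.commute)
      then have "coding n (u div 4) < len slow n" by (rule Suc.IH)
      then have "slow n + u mod 4 * len slow n + coding n (u div 4) < len slow (Suc n)"
        by (intro slow.block_less) simp_all
      then show ?thesis using 3 False by (simp add: slow_eq del: len.simps)
    qed
  qed
qed simp

text \<open>A quarter of a piece is sent to a vertex above that of the piece, so the codings fit together
along the inverse limit.\<close>

lemma bond_coding:
  assumes "u < 2 * 4 ^ Suc n"
  shows "bond slow n (coding (Suc n) u) = coding n (u div 4)"
proof (cases "n = 0")
  case True
  then show ?thesis by (simp add: bond_def)
next
  case False
  consider "u < 3" | "3 \<le> u" "u < 12" | "u \<ge> 12" by linarith
  then show ?thesis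
  proof cases
    case 1
    then show ?thesis by (simp add: coding_small slow.bond_0 del: coding.simps)
  next
    case 2
    then have "coding n (u div 4) = 0" by (intro coding_small) simp
    moreover have "bond slow n (coding (Suc n) u) = 0"
      using 2 len_pos[of slow n] False
      by (cases rule: less_12_cases) (auto simp: bond_def slow_eq Let_def)
    ultimately show ?thesis by simp
  next
    case 3
    have "u div 4 < 2 * 4 ^ n" using assms by (simp add: div_less_iff_less_mult mult.commute)
    then have "coding n (u div 4) < len slow n" by (rule coding_less)
    then have "bond slow n (slow n + u mod 4 * len slow n + coding n (u div 4)) = coding n (u div 4)"
      by (intro bond_block) simp_all
    then show ?thesis using 3 False by (simp add: slow_eq)
  qed
qed

lemma coding_surj:
  "1 \<le> j \<Longrightarrow> j < len slow n \<Longrightarrow> \<exists>u. 3 \<le> u \<and> u < 2 * 4 ^ n \<and> coding n u = j"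
proof (induction n arbitrary: j)
  case (Suc n)
  let ?L = "len slow n"
  show ?case
  proof (cases "n = 0")
    case True
    then show ?thesis using Suc.prems by (intro exI[of _ "j + 2"]) (simp add: slow_def)
  next
    case False
    show ?thesis
    proof (cases "bond slow n j = 0")
      case True
      have big: "12 \<le> 2 * (4::nat) ^ Suc n" using False power_increasing[of 2 "Suc n" "4::nat"] by simp
      have j_less: "j < 6 + 4 * ?L" using Suc.prems False by (simp add: slow_eq)
      have "\<exists>u. 3 \<le> u \<and> u < 12 \<and> coding (Suc n) u = j"
      proof -
        consider "j < 3" | "3 \<le> j" "j < 3 + 4 * ?L" | "j \<ge> 3 + 4 * ?L" by linarith
        then show ?thesis
        proof cases
          case 1
          then consider "j = 1" | "j = 2" using Suc.prems by linarith
          then show ?thesis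
          proof cases
            case 1 then show ?thesis using False by (intro exI[of _ 3]) simp
          next
            case 2 then show ?thesis using False by (intro exI[of _ 4]) simp
          qed
        next
          case 2
          then have "(j - 3) mod ?L = 0" using True False by (simp add: bond_def slow_eq)
          then obtain k where k: "j - 3 = k * ?L" by (metis mod_0_imp_dvd dvdE mult.commute)
          then have "k < 4" using 2 by (metis add_diff_inverse_nat add_less_cancel_left mult_less_cancel2 not_less)
          then consider "k = 0" | "k = 1" | "k = 2" | "k = 3" by linarith
          then show ?thesis
          proof cases
            case 1 then show ?thesis using False k 2 by (intro exI[of _ 5]) simp
          next
            case 2 then show ?thesis using False k \<open>3 \<le> j\<close> by (intro exI[of _ 6]) simp
          next
            case 3 then show ?thesis using False k \<open>3 \<le> j\<close> by (intro exI[of _ 7]) simp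
          next
            case 4 then show ?thesis using False k \<open>3 \<le> j\<close> by (intro exI[of _ 8]) simp
          qed
        next
          case 3
          then consider "j = 3 + 4 * ?L" | "j = 4 + 4 * ?L" | "j = 5 + 4 * ?L"
            using j_less by linarith
          then show ?thesis
          proof cases
            case 1 then show ?thesis using False by (intro exI[of _ 9]) simp
          next
            case 2 then show ?thesis using False by (intro exI[of _ 10]) simp
          next
            case 3 then show ?thesis using False by (intro exI[of _ 11]) simp
          qed
        qed
      qed
      then obtain u where "3 \<le> u" "u < 12" "coding (Suc n) u = j" by blast
      then show ?thesis using big by (intro exI[of _ u]) (simp del: coding.simps power_Suc)
    next
      case bond: False
      then obtain k where k: "k < 4" "j = slow n + k * ?L + bond slow n j"
        using bond_pos_cases[of slow n j "bond slow n j"] by auto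
      obtain v where v: "3 \<le> v" "v < 2 * 4 ^ n" "coding n v = bond slow n j"
        using Suc.IH[of "bond slow n j"] bond bond_less[of slow n j] by auto
      have "(4 * v + k) div 4 = v" "(4 * v + k) mod 4 = k" using k(1) by simp_all
      then have "coding (Suc n) (4 * v + k) = j"
        using v k(2) False by (simp add: slow_eq)
      then show ?thesis using v k(1) by (intro exI[of _ "4 * v + k"]) simp
    qed
  qed
qed simp

lemma coding_unique:
  assumes "1 \<le> j" "j < len slow n"
  shows "\<exists>!u. u < 2 * 4 ^ n \<and> coding n u = j"
proof -
  let ?A = "{3..<2 * 4 ^ n :: nat}"
  obtain m where n: "n = Suc m" using assms by (cases n) auto
  \<comment> \<open>A surjection between finite sets of equal size is injective.\<close>
  have "card ?A = card {1..<len slow n}" using len_slow[of m] n by (simp del: len.simps power_Suc)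
  also have "\<dots> \<le> card (coding n ` ?A)"
    using coding_surj[of _ n] by (intro card_mono) force+
  finally have inj: "inj_on (coding n) ?A"
    by (intro eq_card_imp_inj_on antisym card_image_le) simp_all
  obtain u where u: "3 \<le> u" "u < 2 * 4 ^ n" "coding n u = j"
    using coding_surj[OF assms] by blast
  show ?thesis
  proof (rule ex1I[of _ u])
    fix v assume v: "v < 2 * 4 ^ n \<and> coding n v = j"
    then have "3 \<le> v" using coding_small[of v n] assms by (cases "v < 3") auto
    then show "v = u" using inj_onD[OF inj, of v u] u v by simp
  qed (use u in simp)
qed

definition unit_interval :: "real measure" where
  "unit_interval = restrict_space lborel {0..<1}"

definition point :: "real \<Rightarrow> nat \<Rightarrow> nat" where
  "point w n = coding n (nat \<lfloor>2 * 4 ^ n * w\<rfloor>)"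

lemma floor_less:
  assumes "0 \<le> w" "w < 1"
  shows "nat \<lfloor>2 * 4 ^ n * w\<rfloor> < 2 * 4 ^ n"
proof -
  have "2 * 4 ^ n * w < 2 * 4 ^ n * 1"
    using assms by (intro mult_strict_left_mono) simp_all
  then have "\<lfloor>2 * 4 ^ n * w\<rfloor> < 2 * 4 ^ n" by (simp add: floor_less_iff)
  moreover have "0 \<le> \<lfloor>2 * 4 ^ n * w\<rfloor>" using assms by simp
  ultimately show ?thesis by (subst nat_less_iff) simp_all
qed

lemma point_in_X:
  assumes "0 \<le> w" "w < 1"
  shows "point w \<in> slow.X"
  unfolding slow.X_iff
proof (intro conjI allI)
  fix n
  show "point w n < len slow n"
    unfolding point_def using floor_less[OF assms] by (rule coding_less)
  have "\<lfloor>2 * 4 ^ n * w\<rfloor> = \<lfloor>2 * 4 ^ Suc n * w / real_of_int 4\<rfloor>" by (simp add: field_simps)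
  also have "\<dots> = \<lfloor>2 * 4 ^ Suc n * w\<rfloor> div 4" by (rule floor_divide_real_eq_div) simp
  finally have "nat \<lfloor>2 * 4 ^ Suc n * w\<rfloor> div 4 = nat \<lfloor>2 * 4 ^ n * w\<rfloor>"
    by (simp add: nat_div_distrib del: power_Suc)
  then show "point w n = bond slow n (point w (Suc n))"
    unfolding point_def bond_coding[OF floor_less[OF assms]] by simp
qed

lemma prob_space_unit_interval: "prob_space unit_interval"
  by (rule prob_spaceI) (simp add: unit_interval_def space_restrict_space emeasure_restrict_space)

lemma point_measurable: "point \<in> unit_interval \<rightarrow>\<^sub>M slow.BX"
proof (rule measurable_restrict_space2)
  show "point \<in> space unit_interval \<rightarrow> slow.X"
    by (auto simp: unit_interval_def space_restrict_space intro: point_in_X)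
  show "point \<in> borel_measurable unit_interval"
    unfolding unit_interval_def
  proof (intro measurable_restrict_space1 measurable_coordinatewise_then_product)
    fix n
    have "(\<lambda>w::real. nat \<lfloor>2 * 4 ^ n * w\<rfloor>) \<in> lborel \<rightarrow>\<^sub>M count_space UNIV" by measurable
    then have "(\<lambda>w::real. coding n (nat \<lfloor>2 * 4 ^ n * w\<rfloor>)) \<in> lborel \<rightarrow>\<^sub>M borel"
      by (rule measurable_compose[where g = "coding n"]) simp
    then show "(\<lambda>w. point w n) \<in> borel_measurable lborel" by (simp add: point_def)
  qed
qed

definition coded_measure :: "(nat \<Rightarrow> nat) measure" where
  "coded_measure = distr unit_interval slow.BX point"

lemma coded_measure_cyl:
  assumes "1 \<le> i" "i < len slow n"
  shows "measure coded_measure (slow.cyl n i) = 1 / (2 * 4 ^ n)"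
proof -
  let ?N = "2 * 4 ^ n :: real"
  obtain u where u: "u < 2 * 4 ^ n" "coding n u = i"
    and unique: "\<And>v. v < 2 * 4 ^ n \<Longrightarrow> coding n v = i \<Longrightarrow> v = u"
    using coding_unique[OF assms] by auto
  have Npos: "?N > 0" by simp
  have uN: "real u + 1 \<le> ?N"
  proof -
    have "real (Suc u) \<le> real (2 * 4 ^ n)" using u(1) by (intro of_nat_mono) simp
    then show ?thesis by simp
  qed
  have "point -` slow.cyl n i \<inter> space unit_interval = {real u / ?N ..< (real u + 1) / ?N}"
  proof (intro set_eqI iffI)
    fix w assume "w \<in> point -` slow.cyl n i \<inter> space unit_interval"
    then have w: "0 \<le> w" "w < 1" "coding n (nat \<lfloor>?N * w\<rfloor>) = i"
      by (auto simp: unit_interval_def space_restrict_space point_def)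
    then have "nat \<lfloor>?N * w\<rfloor> = u" using unique floor_less by blast
    then have "\<lfloor>?N * w\<rfloor> = int u" using w(1) by (simp add: nat_eq_iff)
    then have "real u \<le> ?N * w" "?N * w < real u + 1" by linarith+
    then show "w \<in> {real u / ?N ..< (real u + 1) / ?N}"
      using Npos by (simp add: field_simps)
  next
    fix w assume "w \<in> {real u / ?N ..< (real u + 1) / ?N}"
    then have w: "real u \<le> ?N * w" "?N * w < real u + 1"
      using Npos by (simp_all add: field_simps)
    then have "\<lfloor>?N * w\<rfloor> = int u" by linarith
    moreover have "0 \<le> ?N * w" "?N * w < ?N * 1" using w uN by linarith+
    then have "0 \<le> w" "w < 1" using Npos by (simp_all add: zero_le_mult_iff)
    ultimately show "w \<in> point -` slow.cyl n i \<inter> space unit_interval"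
      using u(2) point_in_X by (simp add: unit_interval_def space_restrict_space point_def)
  qed
  moreover have "measure unit_interval {real u / ?N ..< (real u + 1) / ?N} = 1 / ?N"
  proof -
    have sub: "{real u / ?N ..< (real u + 1) / ?N} \<subseteq> {0..<1}"
      using uN Npos by (auto simp: field_simps)
    then have "measure unit_interval {real u / ?N ..< (real u + 1) / ?N} =
        measure lborel {real u / ?N ..< (real u + 1) / ?N}"
      unfolding unit_interval_def by (intro measure_restrict_space) simp_all
    also have "\<dots> = (real u + 1) / ?N - real u / ?N"
      using Npos by (intro measure_lborel_Ico divide_right_mono) simp_all
    finally show ?thesis by (simp add: field_simps)
  qed
  ultimately show ?thesis
    unfolding coded_measure_def by (simp add: measure_distr point_measurable slow.cyl_sets)
qed

lemma coded_measure_invariant: "invariant_measure slow.X slow.f coded_measure"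
proof (rule slow.invariantI)
  show "prob_space coded_measure"
    unfolding coded_measure_def
    by (rule prob_space.prob_space_distr[OF prob_space_unit_interval point_measurable])
  show "sets coded_measure = sets slow.BX" by (simp add: coded_measure_def)
qed (simp add: coded_measure_cyl)

text \<open>The three central pieces of level n have total length \<open>3 / (2 * 4 ^ n)\<close>, which tends to
0.\<close>

lemma coded_measure_fixpt: "measure coded_measure {slow.fixpt} = 0"
proof -
  have eq: "measure coded_measure (slow.cyl (Suc n) 0) = 3 / 8 * (1 / 4) ^ n" for n
  proof -
    have "real (len slow (Suc n)) + 2 = real (len slow (Suc n) + 2)" by simp
    also have "\<dots> = 8 * 4 ^ n" unfolding len_slow by simp
    finally have len: "real (len slow (Suc n)) - 1 = 8 * 4 ^ n - 3" by linarith
    have base: "measure coded_measure (slow.cyl 1 1) = 1 / 8"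
      using coded_measure_cyl[of 1 1] slow.len_Suc_0 by simp
    show ?thesis
      unfolding slow.measure_cyl_0_inv[OF coded_measure_invariant] len base
      by (simp add: field_simps power_divide)
  qed
  have "(\<lambda>n. 3 / 8 * (1 / 4 :: real) ^ n) \<longlonglongrightarrow> 3 / 8 * 0"
    by (intro tendsto_mult_left LIMSEQ_realpow_zero) simp_all
  from LIMSEQ_unique[OF slow.measure_cyl_0_tendsto[OF coded_measure_invariant, unfolded eq] this]
  show ?thesis by simp
qed

section \<open>The examples\<close>

theorem proposition6p33:
  shows
    "(\<exists>(G :: nat \<Rightarrow> nat pair_pre_digraph) \<phi> s s' tbar.
        two_circuit_covering G \<phi> s s' tbar \<and>
        \<not> weakly_mixing (inv_limit G \<phi>) (inv_limit_map G \<phi>)) \<and>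
     (\<exists>(G :: nat \<Rightarrow> nat pair_pre_digraph) \<phi> s s' tbar.
        two_circuit_covering G \<phi> s s' tbar \<and>
        \<not> weakly_mixing (inv_limit G \<phi>) (inv_limit_map G \<phi>) \<and>
        uniquely_ergodic (inv_limit G \<phi>) (inv_limit_map G \<phi>) \<and>
        (\<forall>n\<ge>1. s n = s' n)) \<and>
     (\<exists>(G :: nat \<Rightarrow> nat pair_pre_digraph) \<phi> s s' tbar.
        two_circuit_covering G \<phi> s s' tbar \<and>
        \<not> weakly_mixing (inv_limit G \<phi>) (inv_limit_map G \<phi>) \<and>
        card {M. ergodic_measure (inv_limit G \<phi>) (inv_limit_map G \<phi>) M} = 2 \<and>
        (\<forall>n\<ge>1. s n = s' n))"
proof (intro conjI)
  show "\<exists>(G :: nat \<Rightarrow> nat pair_pre_digraph) \<phi> s s' tbar.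
      two_circuit_covering G \<phi> s s' tbar \<and>
      \<not> weakly_mixing (inv_limit G \<phi>) (inv_limit_map G \<phi>)"
    using fast.two_circuit_covering fast.not_weakly_mixing by blast
  show "\<exists>(G :: nat \<Rightarrow> nat pair_pre_digraph) \<phi> s s' tbar.
      two_circuit_covering G \<phi> s s' tbar \<and>
      \<not> weakly_mixing (inv_limit G \<phi>) (inv_limit_map G \<phi>) \<and>
      uniquely_ergodic (inv_limit G \<phi>) (inv_limit_map G \<phi>) \<and>
      (\<forall>n\<ge>1. s n = s' n)"
    using fast.two_circuit_covering fast.not_weakly_mixing fast_uniquely_ergodic by blast
  show "\<exists>(G :: nat \<Rightarrow> nat pair_pre_digraph) \<phi> s s' tbar.
      two_circuit_covering G \<phi> s s' tbar \<and>
      \<not> weakly_mixing (inv_limit G \<phi>) (inv_limit_map G \<phi>) \<and>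
      card {M. ergodic_measure (inv_limit G \<phi>) (inv_limit_map G \<phi>) M} = 2 \<and>
      (\<forall>n\<ge>1. s n = s' n)"
    using slow.two_circuit_covering slow.not_weakly_mixing
      slow.two_ergodic_measures[OF coded_measure_invariant coded_measure_fixpt] by blast
qed

end
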